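(* Let $\mathcal{S}\subset\mathbb{Z}$ with $\max\mathcal{S}=1$. Let $n(i,s)$ be non-negative integers for $i\in\mathbb{Z}$, $s\in\mathcal{S}$, and assume that either $\min\mathcal{S}=-1$, or $n(i,s)=0$ for all $i<0$ and $s\in\mathcal{S}$. Define $n_i=\sum_{s\in\mathcal{S}}n(i,s)+\chi_{i=0}$, let $\ell$ and $r$ be the smallest and largest $i$ with $n_i>0$, and assume $n_i>0$ for all $\ell\le i\le r$. Then the number of $\mathcal{S}$-ary trees in which, for all $i\in\mathbb{Z}$ and $s\in\mathcal{S}$, exactly $n(i,s)$ non-root vertices have out-type $(i;s)$ is $$\frac{\prod_{i=\ell}^{-1}n(i,-1)\prod_{i=1}^r n(i,1)}{\prod_{i=\ell}^r n_i}\prod_{i,s}\binom{n_{i-s}}{n(i,s)}.$$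
   Context: For $\mathcal{S}\subset\mathbb{Z}$, an $\mathcal{S}$-embedded Cayley tree is a tree on vertex set $\{1,\ldots,n\}$ with a distinguished root, together with abscissas $a(v)\in\mathbb{Z}$ such that the root has abscissa $0$ and $a(v')-a(v)\in\mathcal{S}$ whenever $v'$ is a child of $v$. It is injective if every vertex $v$ has at most one child at abscissa $a(v)+s$ for each $s\in\mathcal{S}$. Two such trees are equivalent if they differ only by a relabelling of vertices preserving the parent relation and abscissas. An $\mathcal{S}$-ary tree is an equivalence class of injective $\mathcal{S}$-embedded Cayley trees. A non-root vertex $v$ has out-type $(i;s)$ if $a(v)=i$ and its parent has abscissa $i-s$. $\chi_P$ is $1$ if $P$ holds and $0$ otherwise; $n_j=0$ for $j$ outside $[\ell,r]$; products over $i,s$ with unspecified range run over $i\in\mathbb{Z}$, $s\in\mathcal{S}$. *)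

theory Defs
  imports Complex_Main "HOL-Library.FuncSet"
begin

text \<open>
  A rooted tree on the vertex set \<open>V\<close> with root \<open>r\<close>, given by its set \<open>C\<close> of
  parent-child pairs: \<open>(u, v) \<in> C\<close> means that \<open>u\<close> is the parent of \<open>v\<close>.
\<close>

definition rooted_tree :: "'v set \<Rightarrow> 'v \<Rightarrow> ('v \<times> 'v) set \<Rightarrow> bool" where
  "rooted_tree V r C \<longleftrightarrow>
     r \<in> V \<and> C \<subseteq> V \<times> V \<and>
     (\<forall>u. (u, r) \<notin> C) \<and>
     (\<forall>v \<in> V - {r}. \<exists>!u. (u, v) \<in> C) \<and>
     (\<forall>v \<in> V. (r, v) \<in> C\<^sup>*)"

record embedded_tree =
  num_verts :: nat
  root :: nat
  child_rel :: "(nat \<times> nat) set"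
  absc :: "nat \<Rightarrow> int"

definition vertices :: "embedded_tree \<Rightarrow> nat set" where
  "vertices t = {1..num_verts t}"

text \<open>
  The abscissa function is extensional (i.e. fixed to \<open>undefined\<close> off the vertex set),
  so that distinct values of the record type are distinct trees.
\<close>

definition embedded_cayley_tree :: "int set \<Rightarrow> embedded_tree \<Rightarrow> bool" where
  "embedded_cayley_tree S t \<longleftrightarrow>
     rooted_tree (vertices t) (root t) (child_rel t) \<and>
     absc t \<in> extensional (vertices t) \<and>
     absc t (root t) = 0 \<and>
     (\<forall>(v, v') \<in> child_rel t. absc t v' - absc t v \<in> S)"

definition injective_tree :: "int set \<Rightarrow> embedded_tree \<Rightarrow> bool" where
  "injective_tree S t \<longleftrightarrow>
     (\<forall>v \<in> vertices t. \<forall>s \<in> S.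
        \<exists>\<^sub>\<le>\<^sub>1 v'. (v, v') \<in> child_rel t \<and> absc t v' = absc t v + s)"

definition tree_equiv :: "embedded_tree \<Rightarrow> embedded_tree \<Rightarrow> bool" where
  "tree_equiv t t' \<longleftrightarrow>
     (\<exists>f. bij_betw f (vertices t) (vertices t') \<and>
          (\<forall>u \<in> vertices t. \<forall>v \<in> vertices t.
             (u, v) \<in> child_rel t \<longleftrightarrow> (f u, f v) \<in> child_rel t') \<and>
          (\<forall>v \<in> vertices t. absc t' (f v) = absc t v))"

definition injective_cayley_trees :: "int set \<Rightarrow> embedded_tree set" where
  "injective_cayley_trees S = {t. embedded_cayley_tree S t \<and> injective_tree S t}"

definition tree_equiv_rel :: "int set \<Rightarrow> (embedded_tree \<times> embedded_tree) set" where
  "tree_equiv_rel S =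
     {(t, t'). t \<in> injective_cayley_trees S \<and> t' \<in> injective_cayley_trees S \<and> tree_equiv t t'}"

definition ary_trees :: "int set \<Rightarrow> embedded_tree set set" where
  "ary_trees S = injective_cayley_trees S // tree_equiv_rel S"

definition out_type_vertices :: "embedded_tree \<Rightarrow> int \<Rightarrow> int \<Rightarrow> nat set" where
  "out_type_vertices t i s =
     {v \<in> vertices t - {root t}.
        absc t v = i \<and> (\<exists>u. (u, v) \<in> child_rel t \<and> absc t u = i - s)}"

text \<open>
  The number of vertices of out-type \<open>(i; s)\<close> is the same for all representatives of a
  class, so it does not matter that all of them are asked for here.
\<close>

definition ary_trees_of_out_types ::
    "int set \<Rightarrow> (int \<Rightarrow> int \<Rightarrow> nat) \<Rightarrow> embedded_tree set set" where
  "ary_trees_of_out_types S n =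
     {T \<in> ary_trees S. \<forall>t \<in> T. \<forall>i. \<forall>s \<in> S. card (out_type_vertices t i s) = n i s}"

text \<open>
  \<open>S\<close> may be infinite, so the sum is \<open>sum'\<close>, which ranges over the nonzero terms.
\<close>

definition vertical_profile :: "int set \<Rightarrow> (int \<Rightarrow> int \<Rightarrow> nat) \<Rightarrow> int \<Rightarrow> nat" where
  "vertical_profile S n i = sum' (n i) S + (if i = 0 then 1 else 0)"

lemma tree_equiv_refl: "tree_equiv t t"
  unfolding tree_equiv_def by (rule exI[of _ "\<lambda>x. x"]) (auto simp: bij_betw_def)

lemma tree_equiv_sym:
  assumes "tree_equiv t t'"
  shows "tree_equiv t' t"
proof -
  obtain f where f: "bij_betw f (vertices t) (vertices t')"
    "\<And>u v. u \<in> vertices t \<Longrightarrow> v \<in> vertices t \<Longrightarrow>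
       (u, v) \<in> child_rel t \<longleftrightarrow> (f u, f v) \<in> child_rel t'"
    "\<And>v. v \<in> vertices t \<Longrightarrow> absc t' (f v) = absc t v"
    using assms unfolding tree_equiv_def by blast
  let ?g = "inv_into (vertices t) f"
  have g: "bij_betw ?g (vertices t') (vertices t)"
    using f(1) by (rule bij_betw_inv_into)
  have gV: "?g v \<in> vertices t" if "v \<in> vertices t'" for v
    using g that by (rule bij_betw_apply)
  have fg: "f (?g v) = v" if "v \<in> vertices t'" for v
    using f(1) that by (rule bij_betw_inv_into_right)
  show ?thesis unfolding tree_equiv_def
    using g gV fg f(2,3) by (intro exI[of _ ?g] conjI ballI) metis+
qed

lemma tree_equiv_trans:
  assumes "tree_equiv t t'" "tree_equiv t' t''"
  shows "tree_equiv t t''"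
proof -
  obtain f where f: "bij_betw f (vertices t) (vertices t')"
    "\<And>u v. u \<in> vertices t \<Longrightarrow> v \<in> vertices t \<Longrightarrow>
       (u, v) \<in> child_rel t \<longleftrightarrow> (f u, f v) \<in> child_rel t'"
    "\<And>v. v \<in> vertices t \<Longrightarrow> absc t' (f v) = absc t v"
    using assms(1) unfolding tree_equiv_def by blast
  obtain g where g: "bij_betw g (vertices t') (vertices t'')"
    "\<And>u v. u \<in> vertices t' \<Longrightarrow> v \<in> vertices t' \<Longrightarrow>
       (u, v) \<in> child_rel t' \<longleftrightarrow> (g u, g v) \<in> child_rel t''"
    "\<And>v. v \<in> vertices t' \<Longrightarrow> absc t'' (g v) = absc t' v"
    using assms(2) unfolding tree_equiv_def by blast
  have fV: "f v \<in> vertices t'" if "v \<in> vertices t" for v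
    using f(1) that by (rule bij_betw_apply)
  show ?thesis unfolding tree_equiv_def
    using bij_betw_trans[OF f(1) g(1)] fV f(2,3) g(2,3)
    by (intro exI[of _ "g \<circ> f"] conjI ballI) auto
qed

lemma equiv_tree_equiv_rel: "equiv (injective_cayley_trees S) (tree_equiv_rel S)"
  by (rule equivI)
     (auto simp: tree_equiv_rel_def refl_on_def sym_def trans_def
           intro: tree_equiv_refl tree_equiv_sym tree_equiv_trans)

end

theory Submission
  imports Defs
begin

text \<open>
  Fix a vertex set \<open>{1..N}\<close> and abscissas \<open>\<tau>\<close> with \<open>n\<^sub>i\<close> vertices at abscissa \<open>i\<close>. As injective trees have no
  nontrivial automorphisms, every class of trees has exactly \<open>\<Prod>\<^sub>i n\<^sub>i!\<close> representatives with these abscissas.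
  Such a representative amounts to a set of occupied child slots \<open>(u, s)\<close>, which can be chosen in
  \<open>\<Prod>\<^sub>i\<^sub>,\<^sub>s binom(n\<^sub>i\<^sub>-\<^sub>s, n(i, s))\<close> ways, together with an acyclic matching of the slots with the non-root
  vertices. For every choice of the slots there are
  \<open>\<Prod>\<^sub>i (n\<^sub>i - 1)! \<cdot> \<Prod>\<^sub>i\<^sub><\<^sub>0 n(i, -1) \<cdot> \<Prod>\<^sub>i\<^sub>>\<^sub>0 n(i, 1)\<close> acyclic matchings. This is shown by contracting edges: a slot
  with extremal target is matched with some vertex, which is merged into the owner of the slot.
\<close>

section \<open>Acyclic matchings of slots with vertices\<close>

text \<open>Acyclicity is a global condition, so slots cannot be filled independently. Contraction
  makes the count local, but a slot may then change its owner; hence slots are abstract elements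
  with a movable owner and a fixed target instead of pairs (u, s). The count closes up under
  contraction because at an extremal type t only two numbers matter: the number N of vertices of
  type t, and the number m of slots with target t owned one unit nearer to 0. Jumps away from 0 have
  length at most 1, so the other N - m slots with target t are owned by vertices of type t. When one
  of the m slots receives v, it disappears, and the slots with target t owned by v join the m - 1
  remaining ones. Summed over the N choices of v, the new values of m add up to N (m - 1) + (N - m)
  = (N - 1) m, and this turns the inductive factor (N - 2)! into (N - 1)! m. In the trees, m is n(i,
  1) for i > 0 and n(i, -1) for i < 0, whatever slots are occupied; therefore choices of slots and
  matchings multiply. The denominator of the theorem is what remains of the n_i! representatives
  against (n_i - 1)!.\<close>

lemma card_PiE_insert_split:
  assumes "finite A" "finite B" "x \<notin> A"
  shows "card {f \<in> insert x A \<rightarrow>\<^sub>E B. P f} = (\<Sum>w\<in>B. card {f \<in> A \<rightarrow>\<^sub>E B. P (f(x := w))})"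
proof -
  let ?T = "SIGMA w:B. {f \<in> A \<rightarrow>\<^sub>E B. P (f(x := w))}"
  let ?h = "\<lambda>(w, f). f(x := w)"
  have "inj_on ?h ?T"
  proof (rule inj_onI, clarify)
    fix w f w' f'
    assume f: "f \<in> A \<rightarrow>\<^sub>E B" "f' \<in> A \<rightarrow>\<^sub>E B" and eq: "f(x := w) = f'(x := w')"
    have "w = w'" using fun_cong[OF eq, of x] by simp
    moreover have "f y = f' y" for y
      using fun_cong[OF eq, of y] f assms(3) by (cases "y = x") (auto simp: PiE_def extensional_def)
    ultimately show "w = w' \<and> f = f'" by auto
  qed
  moreover have "{f \<in> insert x A \<rightarrow>\<^sub>E B. P f} = ?h ` ?T"
    by (auto simp: PiE_insert_eq image_iff)
  moreover have "finite {f \<in> A \<rightarrow>\<^sub>E B. P (f(x := w))}" for w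
    using assms by (intro finite_subset[OF _ finite_PiE[of A "\<lambda>_. B"]]) auto
  ultimately show ?thesis using assms by (simp add: card_image card_SigmaI)
qed

section \<open>Contraction of an edge\<close>

text \<open>Collapsing v onto u carries paths of \<open>E\<close> to paths of the contracted
  relation, and a contracted edge (u, g) with g in \<open>G\<close> unfolds to the path u, v, g.
  This works because (u, v) is the only edge into v.\<close>

lemma acyclic_contract_edge:
  assumes edges: "E = insert (u, v) (F \<union> {v} \<times> G)"
    and F: "\<And>a b. (a, b) \<in> F \<Longrightarrow> a \<noteq> v \<and> b \<noteq> v" and G: "v \<notin> G" and uv: "u \<noteq> v"
  shows "acyclic E \<longleftrightarrow> acyclic (F \<union> {u} \<times> G)"
proof
  assume ac: "acyclic E"
  have "F \<union> {u} \<times> G \<subseteq> E\<^sup>+"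
    using edges by (auto intro: trancl_into_trancl[of u v])
  then have "(F \<union> {u} \<times> G)\<^sup>+ \<subseteq> E\<^sup>+"
    by (metis trancl_id trans_trancl trancl_mono_subset)
  with ac show "acyclic (F \<union> {u} \<times> G)" unfolding acyclic_def by blast
next
  let ?E' = "F \<union> {u} \<times> G"
  define h where "h x = (if x = v then u else x)" for x
  assume ac: "acyclic ?E'"
  have step: "(h a, b) \<in> ?E'" if "(a, b) \<in> E" "b \<noteq> v" for a b
    using that edges F by (auto simp: h_def)
  have into_v: "a = u" if "(a, v) \<in> E" for a
    using that edges F G by auto
  \<comment> \<open>The edge (u, v) by itself collapses to the empty path, which is the exceptional
    disjunct. It closes no cycle, as \<open>u \<noteq> v\<close>.\<close>
  have *: "(h a, h b) \<in> ?E'\<^sup>+ \<or> (a = u \<and> b = v)" if "(a, b) \<in> E\<^sup>+" for a b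
    using that
  proof (induction rule: trancl_induct)
    case (base b)
    show ?case
    proof (cases "b = v")
      case True
      then show ?thesis using into_v base by auto
    next
      case False
      with step[OF base] show ?thesis by (auto simp: h_def)
    qed
  next
    case (step b c)
    show ?case
    proof (cases "c = v")
      case True
      with step into_v have "b = u" by auto
      with step.IH uv True show ?thesis by (auto simp: h_def)
    next
      case False
      with \<open>\<And>a b. (a, b) \<in> E \<Longrightarrow> b \<noteq> v \<Longrightarrow> (h a, b) \<in> ?E'\<close>[OF step.hyps(2)]
      have bc: "(h b, h c) \<in> ?E'" by (auto simp: h_def)
      show ?thesis using step.IH
      proof
        assume "(h a, h b) \<in> ?E'\<^sup>+"
        with bc show ?thesis by (blast intro: trancl_into_trancl)
      next
        assume "a = u \<and> b = v"
        then have "h a = h b" using uv by (simp add: h_def)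
        with bc show ?thesis by auto
      qed
    qed
  qed
  show "acyclic E"
    unfolding acyclic_def using * ac uv by (metis acyclic_def)
qed

text \<open>
  \<open>E\<close> is the set of occupied child slots; slot \<open>e\<close> belongs to the vertex \<open>own e\<close> and has to receive a
  vertex of type \<open>tgt e\<close>. A placement fills every slot; the vertex left over is the root.
\<close>

definition slot_placements ::
    "'v set \<Rightarrow> ('v \<Rightarrow> int) \<Rightarrow> 'e set \<Rightarrow> ('e \<Rightarrow> 'v) \<Rightarrow> ('e \<Rightarrow> int) \<Rightarrow> ('e \<Rightarrow> 'v) set" where
  "slot_placements V \<tau> E own tgt =
     {\<phi> \<in> E \<rightarrow>\<^sub>E V. inj_on \<phi> E \<and> (\<forall>e\<in>E. \<tau> (\<phi> e) = tgt e) \<and>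
        acyclic ((\<lambda>e. (own e, \<phi> e)) ` E)}"

text \<open>If slot \<open>e0\<close> receives \<open>v\<close>, then \<open>v\<close> can be merged into the owner of \<open>e0\<close>, which inherits its slots.\<close>

lemma card_slot_placements_contract:
  assumes fin: "finite V" "finite E" and e0: "e0 \<in> E"
  shows "card (slot_placements V \<tau> E own tgt) =
    (\<Sum>v \<in> {v \<in> V. \<tau> v = tgt e0 \<and> v \<noteq> own e0}.
       card (slot_placements (V - {v}) \<tau> (E - {e0})
               (\<lambda>e. if own e = v then own e0 else own e) tgt))"
proof -
  let ?D = "E - {e0}"
  let ?P = "\<lambda>\<phi>. inj_on \<phi> E \<and> (\<forall>e\<in>E. \<tau> (\<phi> e) = tgt e) \<and> acyclic ((\<lambda>e. (own e, \<phi> e)) ` E)"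
  have E: "E = insert e0 ?D" using e0 by auto
  have "card (slot_placements V \<tau> E own tgt) = card {\<phi> \<in> insert e0 ?D \<rightarrow>\<^sub>E V. ?P \<phi>}"
    unfolding slot_placements_def using E by simp
  also have "\<dots> = (\<Sum>v\<in>V. card {\<phi> \<in> ?D \<rightarrow>\<^sub>E V. ?P (\<phi>(e0 := v))})"
    by (rule card_PiE_insert_split) (use fin in auto)
  also have "\<dots> = (\<Sum>v \<in> {v \<in> V. \<tau> v = tgt e0 \<and> v \<noteq> own e0}.
      card {\<phi> \<in> ?D \<rightarrow>\<^sub>E V. ?P (\<phi>(e0 := v))})"
  proof (rule sum.mono_neutral_right)
    show "\<forall>v\<in>V - {v \<in> V. \<tau> v = tgt e0 \<and> v \<noteq> own e0}.
        card {\<phi> \<in> ?D \<rightarrow>\<^sub>E V. ?P (\<phi>(e0 := v))} = 0"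
    proof
      fix v assume v: "v \<in> V - {v \<in> V. \<tau> v = tgt e0 \<and> v \<noteq> own e0}"
      have "\<not> ?P (\<phi>(e0 := v))" for \<phi>
      proof
        assume P: "?P (\<phi>(e0 := v))"
        then have "\<tau> v = tgt e0" using e0 by auto
        with v have "v = own e0" by auto
        then have "(v, v) \<in> (\<lambda>e. (own e, (\<phi>(e0 := v)) e)) ` E" using e0 by force
        with P show False unfolding acyclic_def by blast
      qed
      then have "{\<phi> \<in> ?D \<rightarrow>\<^sub>E V. ?P (\<phi>(e0 := v))} = {}" by blast
      then show "card {\<phi> \<in> ?D \<rightarrow>\<^sub>E V. ?P (\<phi>(e0 := v))} = 0" by (simp only: card.empty)
    qed
  qed (use fin in auto)
  also have "\<dots> = (\<Sum>v \<in> {v \<in> V. \<tau> v = tgt e0 \<and> v \<noteq> own e0}.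
       card (slot_placements (V - {v}) \<tau> ?D (\<lambda>e. if own e = v then own e0 else own e) tgt))"
  proof (intro sum.cong refl arg_cong[of _ _ card] set_eqI)
    fix v \<phi> assume v: "v \<in> {v \<in> V. \<tau> v = tgt e0 \<and> v \<noteq> own e0}"
    let ?own = "\<lambda>e. if own e = v then own e0 else own e"
    let ?\<phi> = "\<phi>(e0 := v)"
    have inj: "inj_on ?\<phi> E \<longleftrightarrow> inj_on \<phi> ?D \<and> v \<notin> \<phi> ` ?D"
      by (subst E, subst inj_on_insert) (auto simp: inj_on_def)
    have tau: "(\<forall>e\<in>E. \<tau> (?\<phi> e) = tgt e) \<longleftrightarrow> (\<forall>e\<in>?D. \<tau> (\<phi> e) = tgt e)"
      using v by auto
    \<comment> \<open>If v fills a further slot, injectivity fails on the left and the codomain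
      \<open>V - {v}\<close> is violated on the right, so acyclicity has to be compared only when it
      does not.\<close>
    have acy: "acyclic ((\<lambda>e. (own e, ?\<phi> e)) ` E) \<longleftrightarrow> acyclic ((\<lambda>e. (?own e, \<phi> e)) ` ?D)"
      if nv: "v \<notin> \<phi> ` ?D"
    proof -
      let ?F = "(\<lambda>e. (own e, \<phi> e)) ` {e \<in> ?D. own e \<noteq> v}" and ?G = "\<phi> ` {e \<in> ?D. own e = v}"
      have 1: "(\<lambda>e. (own e, ?\<phi> e)) ` E = insert (own e0, v) (?F \<union> {v} \<times> ?G)"
      proof -
        have "?D = {e \<in> ?D. own e \<noteq> v} \<union> {e \<in> ?D. own e = v}" by auto
        then have "(\<lambda>e. (own e, \<phi> e)) ` ?D = ?F \<union> (\<lambda>e. (own e, \<phi> e)) ` {e \<in> ?D. own e = v}"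
          by (metis (no_types, lifting) image_Un)
        also have "(\<lambda>e. (own e, \<phi> e)) ` {e \<in> ?D. own e = v} = {v} \<times> ?G" by auto
        finally have "insert (own e0, v) ((\<lambda>e. (own e, \<phi> e)) ` ?D) = insert (own e0, v) (?F \<union> {v} \<times> ?G)"
          by simp
        moreover have "(\<lambda>e. (own e, ?\<phi> e)) ` ?D = (\<lambda>e. (own e, \<phi> e)) ` ?D" by auto
        ultimately show ?thesis by (subst E) (simp only: image_insert fun_upd_same)
      qed
      have 2: "(\<lambda>e. (?own e, \<phi> e)) ` ?D = ?F \<union> {own e0} \<times> ?G"
      proof -
        have "?D = {e \<in> ?D. own e \<noteq> v} \<union> {e \<in> ?D. own e = v}" by auto
        then have "(\<lambda>e. (?own e, \<phi> e)) ` ?D =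
          (\<lambda>e. (?own e, \<phi> e)) ` {e \<in> ?D. own e \<noteq> v} \<union> (\<lambda>e. (?own e, \<phi> e)) ` {e \<in> ?D. own e = v}"
          by (metis (no_types, lifting) image_Un)
        also have "(\<lambda>e. (?own e, \<phi> e)) ` {e \<in> ?D. own e = v} = {own e0} \<times> ?G" by auto
        also have "(\<lambda>e. (?own e, \<phi> e)) ` {e \<in> ?D. own e \<noteq> v} = ?F" by auto
        finally show ?thesis .
      qed
      show ?thesis unfolding 2
        by (rule acyclic_contract_edge[OF 1]) (use nv v in auto)
    qed
    show "\<phi> \<in> {\<phi> \<in> ?D \<rightarrow>\<^sub>E V. ?P (\<phi>(e0 := v))} \<longleftrightarrow>
      \<phi> \<in> slot_placements (V - {v}) \<tau> ?D ?own tgt"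
    proof (cases "v \<in> \<phi> ` ?D")
      case True
      then show ?thesis unfolding slot_placements_def mem_Collect_eq inj by auto
    next
      case False
      then have "\<phi> \<in> ?D \<rightarrow>\<^sub>E V \<longleftrightarrow> \<phi> \<in> ?D \<rightarrow>\<^sub>E (V - {v})"
        by (auto simp: PiE_iff)
      then show ?thesis
        unfolding slot_placements_def mem_Collect_eq inj tau acy[OF False] using False by blast
    qed
  qed
  finally show ?thesis .
qed

definition toward_zero :: "int \<Rightarrow> int" where
  "toward_zero i = (if 0 < i then i - 1 else i + 1)"

text \<open>
  A slot with target \<open>i > 0\<close> is owned by a vertex of type at least \<open>i - 1\<close>, and symmetrically for \<open>i < 0\<close>.
  Contracting slots whose target \<open>t\<close> has maximal absolute value preserves this, since the
  owner then has type \<open>t\<close> or \<open>toward_zero t\<close>.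
\<close>

lemma card_slot_placements:
  fixes \<tau> :: "'v \<Rightarrow> int" and tgt :: "'e \<Rightarrow> int"
  assumes "finite V" "finite E" "\<And>e. e \<in> E \<Longrightarrow> own e \<in> V"
    and "\<And>i. card {v \<in> V. \<tau> v = i} = card {e \<in> E. tgt e = i} + (if i = 0 then 1 else 0)"
    and "\<And>e. e \<in> E \<Longrightarrow> 0 < tgt e \<Longrightarrow> tgt e - 1 \<le> \<tau> (own e)"
    and "\<And>e. e \<in> E \<Longrightarrow> tgt e < 0 \<Longrightarrow> \<tau> (own e) \<le> tgt e + 1"
    and "\<And>v. v \<in> V \<Longrightarrow> \<tau> v \<noteq> 0 \<Longrightarrow> toward_zero (\<tau> v) \<in> \<tau> ` V"
  shows "card (slot_placements V \<tau> E own tgt) =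
    (\<Prod>i\<in>\<tau> ` V. fact (card {v \<in> V. \<tau> v = i} - 1)) *
    (\<Prod>i\<in>\<tau> ` V - {0}. card {e \<in> E. tgt e = i \<and> \<tau> (own e) = toward_zero i})"
  using assms
proof (induction "card E" arbitrary: V E own rule: less_induct)
  case less
  note fin = less.prems(1,2) and own = less.prems(3) and count = less.prems(4)
    and up = less.prems(5) and down = less.prems(6) and closed = less.prems(7)
  define m where "m i = card {e \<in> E. tgt e = i \<and> \<tau> (own e) = toward_zero i}" for i
  define N where "N i = card {v \<in> V. \<tau> v = i}" for i
  have V_ne: "V \<noteq> {}" using count[of 0] by auto
  have tgt_V: "tgt e \<in> \<tau> ` V" if "e \<in> E" for e
  proof -
    have "card {e' \<in> E. tgt e' = tgt e} > 0" using that fin by (subst card_gt_0_iff) auto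
    then have "card {v \<in> V. \<tau> v = tgt e} > 0" using count[of "tgt e"] by linarith
    then obtain v where "v \<in> V" "\<tau> v = tgt e" by (subst (asm) card_gt_0_iff) auto
    then show ?thesis by (metis image_eqI)
  qed
  obtain t where t: "t \<in> \<tau> ` V" "\<And>i. i \<in> \<tau> ` V \<Longrightarrow> \<bar>i\<bar> \<le> \<bar>t\<bar>"
  proof -
    have "Max (abs ` \<tau> ` V) \<in> abs ` \<tau> ` V" using V_ne fin by (intro Max_in) auto
    then obtain t where "t \<in> \<tau> ` V" "Max (abs ` \<tau> ` V) = \<bar>t\<bar>" by auto
    then show thesis using that[of t] fin by (metis Max_ge finite_imageI image_eqI)
  qed
  \<comment> \<open>The slots of v pass to an owner of type \<open>toward_zero t\<close>, which
    still satisfies the bounds \<open>up\<close> and \<open>down\<close> because no target lies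
    farther from 0 than t. For t = 0 all targets are 0 and the bounds are vacuous.\<close>
  have contract: "card (slot_placements (V - {v}) \<tau> (E - {e0})
        (\<lambda>e. if own e = v then own e0 else own e) tgt) =
      (\<Prod>i\<in>\<tau> ` (V - {v}). fact (card {x \<in> V - {v}. \<tau> x = i} - 1)) *
      (\<Prod>i\<in>\<tau> ` (V - {v}) - {0}. card {e \<in> E - {e0}. tgt e = i \<and>
          \<tau> (if own e = v then own e0 else own e) = toward_zero i})"
    if e0: "e0 \<in> E" "tgt e0 = t" and v: "v \<in> V" "\<tau> v = t" "own e0 \<noteq> v"
      and own_e0: "t = 0 \<or> \<tau> (own e0) = toward_zero t" for v e0
  proof (rule less.hyps)
    show "card (E - {e0}) < card E" using e0 fin by (intro card_Diff1_less) auto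
    show "finite (V - {v})" "finite (E - {e0})" using fin by auto
    show "(if own e = v then own e0 else own e) \<in> V - {v}" if "e \<in> E - {e0}" for e
      using that own e0 v by auto
    show "card {x \<in> V - {v}. \<tau> x = i} = card {e \<in> E - {e0}. tgt e = i} + (if i = 0 then 1 else 0)" for i
    proof (cases "i = t")
      case True
      have "{x \<in> V - {v}. \<tau> x = i} = {x \<in> V. \<tau> x = i} - {v}"
        "{e \<in> E - {e0}. tgt e = i} = {e \<in> E. tgt e = i} - {e0}" by auto
      moreover have "v \<in> {x \<in> V. \<tau> x = i}" "e0 \<in> {e \<in> E. tgt e = i}" using True v e0 by auto
      moreover have "card {e \<in> E. tgt e = i} > 0" using True e0 fin by (subst card_gt_0_iff) auto
      ultimately show ?thesis using count[of i] fin by (simp add: card_Diff_singleton)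
    next
      case False
      then have "{x \<in> V - {v}. \<tau> x = i} = {x \<in> V. \<tau> x = i}"
        "{e \<in> E - {e0}. tgt e = i} = {e \<in> E. tgt e = i}" using v e0 by auto
      then show ?thesis using count[of i] by simp
    qed
    show "tgt e - 1 \<le> \<tau> (if own e = v then own e0 else own e)" if "e \<in> E - {e0}" "0 < tgt e" for e
    proof -
      have e: "e \<in> E" using that by auto
      show ?thesis using up[OF e that(2)] t(2)[OF tgt_V[OF e]] own_e0 v that(2)
        by (auto simp: toward_zero_def split: if_splits)
    qed
    show "\<tau> (if own e = v then own e0 else own e) \<le> tgt e + 1" if "e \<in> E - {e0}" "tgt e < 0" for e
    proof -
      have e: "e \<in> E" using that by auto
      show ?thesis using down[OF e that(2)] t(2)[OF tgt_V[OF e]] own_e0 v that(2)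
        by (auto simp: toward_zero_def split: if_splits)
    qed
    show "toward_zero (\<tau> x) \<in> \<tau> ` (V - {v})" if x0: "x \<in> V - {v}" "\<tau> x \<noteq> 0" for x
    proof -
      have x: "x \<in> V" using x0 by auto
      obtain y where y: "y \<in> V" "\<tau> y = toward_zero (\<tau> x)" using closed[OF x x0(2)] by auto
      \<comment> \<open>On nonzero types \<open>toward_zero\<close> lowers the absolute value by 1,
        so it never hits the extremal t.\<close>
      moreover have "\<tau> y \<noteq> t"
        using y(2) t(2)[of "\<tau> x"] x x0(2) by (auto simp: toward_zero_def split: if_splits)
      ultimately show ?thesis using v by (intro image_eqI[of _ _ y]) auto
    qed
  qed
  show ?case
  proof (cases "t = 0")
    case True
    then have \<tau>0: "\<tau> v = 0" if "v \<in> V" for v using t(2)[of "\<tau> v"] that by auto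
    then have img: "\<tau> ` V = {0}" using V_ne by force
    have "{v \<in> V. \<tau> v = 0} = V" using \<tau>0 by auto
    have tgt0: "tgt e = 0" if "e \<in> E" for e using tgt_V[OF that] img by auto
    then have "{e \<in> E. tgt e = 0} = E" by auto
    with count[of 0] \<open>{v \<in> V. \<tau> v = 0} = V\<close> have cardV: "card V = card E + 1" by simp
    have rhs: "(\<Prod>i\<in>\<tau> ` V. fact (card {v \<in> V. \<tau> v = i} - 1)) *
        (\<Prod>i\<in>\<tau> ` V - {0}. card {e \<in> E. tgt e = i \<and> \<tau> (own e) = toward_zero i}) = (fact (card E) :: nat)"
      using img \<open>{v \<in> V. \<tau> v = 0} = V\<close> cardV by simp
    show ?thesis
    proof (cases "E = {}")
      case True
      then show ?thesis unfolding rhs by (simp add: slot_placements_def acyclic_def)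
    next
      case False
      then obtain e0 where e0: "e0 \<in> E" by auto
      \<comment> \<open>With 0 as the only type, a slot accepts every vertex but its owner, that is
        \<open>card V - 1 = card E\<close> vertices.\<close>
      have "card (slot_placements V \<tau> E own tgt) =
        (\<Sum>v \<in> {v \<in> V. \<tau> v = tgt e0 \<and> v \<noteq> own e0}. fact (card E - 1))"
        unfolding card_slot_placements_contract[OF fin e0]
      proof (rule sum.cong[OF refl])
        fix v assume v: "v \<in> {v \<in> V. \<tau> v = tgt e0 \<and> v \<noteq> own e0}"
        have "\<tau> ` (V - {v}) = {0}" using \<tau>0 v own[OF e0] by (force simp: image_iff)
        moreover have "{x \<in> V - {v}. \<tau> x = 0} = V - {v}" using \<tau>0 by auto
        ultimately show "card (slot_placements (V - {v}) \<tau> (E - {e0})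
            (\<lambda>e. if own e = v then own e0 else own e) tgt) = fact (card E - 1)"
          using contract[of e0 v] e0 v tgt0[OF e0] True cardV fin by auto
      qed
      also have "{v \<in> V. \<tau> v = tgt e0 \<and> v \<noteq> own e0} = V - {own e0}"
        using \<tau>0 tgt0[OF e0] by auto
      also have "(\<Sum>v\<in>V - {own e0}. fact (card E - 1)) = card E * (fact (card E - 1) :: nat)"
        using own[OF e0] cardV by simp
      also have "\<dots> = fact (card E)"
        using False fin by (subst (2) fact_reduce) (auto simp: card_gt_0_iff)
      finally show ?thesis unfolding rhs .
    qed
  next
    case t0: False
    have leaf: "\<tau> (own e) = t \<or> \<tau> (own e) = toward_zero t" if "e \<in> E" "tgt e = t" for e
      using up[OF that(1)] down[OF that(1)] t(2)[of "\<tau> (own e)"] own[OF that(1)] that(2) t0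
      by (auto simp: toward_zero_def)
    have tz: "toward_zero t \<noteq> t" by (simp add: toward_zero_def)
    have count_t: "N t = card {e \<in> E. tgt e = t}" using count[of t] t0 by (simp add: N_def)
    have Nt: "N t > 0" using t(1) fin unfolding N_def by (subst card_gt_0_iff) auto
    \<comment> \<open>The factors of the types other than t, on which the contraction has no
      effect.\<close>
    define R where "R = (\<Prod>i\<in>\<tau> ` V - {t}. fact (N i - 1)) * (\<Prod>i\<in>\<tau> ` V - {0, t}. m i)"
    have img0: "insert t (\<tau> ` V - {0, t}) = \<tau> ` V - {0}" using t(1) t0 by auto
    have rhs: "(\<Prod>i\<in>\<tau> ` V. fact (card {v \<in> V. \<tau> v = i} - 1)) *
        (\<Prod>i\<in>\<tau> ` V - {0}. card {e \<in> E. tgt e = i \<and> \<tau> (own e) = toward_zero i})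
        = fact (N t - 1) * m t * R"
      unfolding N_def[symmetric] m_def[symmetric] R_def img0[symmetric]
      using fin t(1) by (simp add: prod.remove[of "\<tau> ` V" t])
    show ?thesis
    proof (cases "m t = 0")
      case True
      \<comment> \<open>As t is nonzero, all vertices of type t are placed, and here each would be
        placed in a slot owned by a vertex of type t again. A minimal vertex of type t for the
        acyclic parent relation contradicts this.\<close>
      have "slot_placements V \<tau> E own tgt = {}"
      proof (rule ccontr)
        assume "slot_placements V \<tau> E own tgt \<noteq> {}"
        then obtain \<phi> where \<phi>: "\<phi> \<in> E \<rightarrow> V" "inj_on \<phi> E" "\<And>e. e \<in> E \<Longrightarrow> \<tau> (\<phi> e) = tgt e"
          "acyclic ((\<lambda>e. (own e, \<phi> e)) ` E)"
          unfolding slot_placements_def by (auto simp: PiE_def)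
        let ?Et = "{e \<in> E. tgt e = t}" and ?Vt = "{v \<in> V. \<tau> v = t}"
        have "card (\<phi> ` ?Et) = card ?Vt"
          using count_t \<phi>(2) unfolding N_def by (subst card_image) (auto intro: inj_on_subset)
        moreover have "\<phi> ` ?Et \<subseteq> ?Vt" using \<phi> by auto
        ultimately have surj: "\<phi> ` ?Et = ?Vt" using fin by (intro card_subset_eq) auto
        have "wf ((\<lambda>e. (own e, \<phi> e)) ` E)"
          using \<phi>(4) fin by (intro finite_acyclic_wf) auto
        moreover obtain v where "v \<in> ?Vt" using t(1) by auto
        ultimately obtain z where z: "z \<in> ?Vt" "\<And>y. (y, z) \<in> (\<lambda>e. (own e, \<phi> e)) ` E \<Longrightarrow> y \<notin> ?Vt"
          by (rule wfE_min) blast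
        from z(1) have "z \<in> \<phi> ` ?Et" unfolding surj .
        then obtain e where e: "e \<in> E" "tgt e = t" "z = \<phi> e" by blast
        have "own e \<notin> ?Vt" using z(2)[of "own e"] e by auto
        then have "\<tau> (own e) = toward_zero t" using leaf[OF e(1,2)] own[OF e(1)] by auto
        with True e fin show False by (auto simp: m_def)
      qed
      then show ?thesis unfolding rhs using True by simp
    next
      case False
      then have "{e \<in> E. tgt e = t \<and> \<tau> (own e) = toward_zero t} \<noteq> {}"
        unfolding m_def by (metis card.empty)
      then obtain e0 where e0: "e0 \<in> E" "tgt e0 = t" "\<tau> (own e0) = toward_zero t" by blast
      define c where "c v = card {e \<in> E. tgt e = t \<and> own e = v}" for v
      \<comment> \<open>Slots of v are not counted before the contraction, since t is not of the
        form \<open>toward_zero i\<close>. They are not counted afterwards either: for distinct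
        nonzero i and t, \<open>toward_zero i = toward_zero t\<close> happens only if one is 1 and
        the other -1, and then \<open>up\<close> or \<open>down\<close> forbids v to own a slot with
        target i.\<close>
      have m_other: "card {e \<in> E - {e0}. tgt e = i \<and>
          \<tau> (if own e = v then own e0 else own e) = toward_zero i} = m i"
        if "v \<in> V" "\<tau> v = t" "i \<in> \<tau> ` V" "i \<noteq> 0" "i \<noteq> t" for v i
      proof -
        have 1: "toward_zero i \<noteq> t"
          using t(2)[OF that(3)] that(4) by (auto simp: toward_zero_def)
        have 2: "toward_zero t \<noteq> toward_zero i" if "e \<in> E" "tgt e = i" "own e = v" for e
          using up[OF that(1)] down[OF that(1)] t(2)[OF \<open>i \<in> \<tau> ` V\<close>] that \<open>\<tau> v = t\<close> \<open>i \<noteq> 0\<close> \<open>i \<noteq> t\<close>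
          by (auto simp: toward_zero_def split: if_splits)
        show ?thesis unfolding m_def
          by (rule arg_cong[of _ _ card]) (use 1 2 that e0 in \<open>auto; blast\<close>)
      qed
      \<comment> \<open>The slot e0 is lost, while the \<open>c v\<close> slots with target t owned
        by v move to an owner of type \<open>toward_zero t\<close> and enter the count.\<close>
      have m_t: "card {e \<in> E - {e0}. tgt e = t \<and>
          \<tau> (if own e = v then own e0 else own e) = toward_zero t} = m t - 1 + c v"
        if v: "v \<in> V" "\<tau> v = t" for v
      proof -
        let ?M = "{e \<in> E. tgt e = t \<and> \<tau> (own e) = toward_zero t}"
        have "{e \<in> E - {e0}. tgt e = t \<and> \<tau> (if own e = v then own e0 else own e) = toward_zero t}
          = (?M - {e0}) \<union> {e \<in> E. tgt e = t \<and> own e = v}"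
          using e0 v tz by auto
        also have "card \<dots> = card (?M - {e0}) + c v"
          unfolding c_def by (rule card_Un_disjoint) (use fin v tz in auto)
        also have "card (?M - {e0}) = m t - 1"
          unfolding m_def using e0 fin by (subst card_Diff_singleton) auto
        finally show ?thesis .
      qed
      have sum_c: "(\<Sum>v | v \<in> V \<and> \<tau> v = t. c v) + m t = N t"
      proof -
        let ?M = "{e \<in> E. tgt e = t \<and> \<tau> (own e) = toward_zero t}"
        have "(\<Sum>v | v \<in> V \<and> \<tau> v = t. c v) = card (\<Union>v\<in>{v \<in> V. \<tau> v = t}. {e \<in> E. tgt e = t \<and> own e = v})"
          unfolding c_def using fin by (subst card_UN_disjoint) auto
        also have "\<dots> + m t = card ((\<Union>v\<in>{v \<in> V. \<tau> v = t}. {e \<in> E. tgt e = t \<and> own e = v}) \<union> ?M)"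
          unfolding m_def using fin tz by (intro card_Un_disjoint[symmetric]) auto
        also have "(\<Union>v\<in>{v \<in> V. \<tau> v = t}. {e \<in> E. tgt e = t \<and> own e = v}) \<union> ?M = {e \<in> E. tgt e = t}"
          using leaf own by auto
        finally show ?thesis using count_t by simp
      qed
      have N_other: "card {x \<in> V - {v}. \<tau> x = i} = N i" if "\<tau> v = t" "i \<noteq> t" for v i
        unfolding N_def by (rule arg_cong[of _ _ card]) (use that in auto)
      have N_t: "card {x \<in> V - {v}. \<tau> x = t} = N t - 1" if v: "v \<in> V" "\<tau> v = t" for v
      proof -
        have "{x \<in> V - {v}. \<tau> x = t} = {x \<in> V. \<tau> x = t} - {v}" by auto
        then show ?thesis unfolding N_def using v fin by (simp add: card_Diff_singleton)
      qed
      have dom: "{v \<in> V. \<tau> v = tgt e0 \<and> v \<noteq> own e0} = {v \<in> V. \<tau> v = t}"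
        using e0 tz by auto
      have "card (slot_placements V \<tau> E own tgt) = fact (N t - 1) * m t * R"
      proof (cases "N t = 1")
        \<comment> \<open>Removing the only vertex of type t removes t from the index sets of both
          products. Here \<open>m t = 1\<close>, so no factor is lost.\<close>
        case True
        then obtain v where v: "{v \<in> V. \<tau> v = t} = {v}" unfolding N_def by (auto simp: card_1_singleton_iff)
        then have v': "v \<in> V" "\<tau> v = t" by auto
        have img: "\<tau> ` (V - {v}) = \<tau> ` V - {t}" using v by blast
        have "card (slot_placements V \<tau> E own tgt) = card (slot_placements (V - {v}) \<tau> (E - {e0})
            (\<lambda>e. if own e = v then own e0 else own e) tgt)"
          unfolding card_slot_placements_contract[OF fin e0(1)] dom v by simp
        also have "\<dots> = (\<Prod>i\<in>\<tau> ` V - {t}. fact (card {x \<in> V - {v}. \<tau> x = i} - 1)) *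
            (\<Prod>i\<in>\<tau> ` V - {t} - {0}. card {e \<in> E - {e0}. tgt e = i \<and>
              \<tau> (if own e = v then own e0 else own e) = toward_zero i})"
        proof -
          have "own e0 \<noteq> v" using e0 v' tz by auto
          from contract[OF e0(1,2) v' this] e0(3) show ?thesis unfolding img by blast
        qed
        also have "\<dots> = R"
          unfolding R_def using N_other[OF v'(2)] m_other[OF v']
          by (intro arg_cong2[of _ _ _ _ "(*)"] prod.cong) auto
        finally show ?thesis using True False sum_c by simp
      next
        case N2: False
        have img: "\<tau> ` (V - {v}) = \<tau> ` V" if v: "v \<in> V" "\<tau> v = t" for v
        proof -
          have "card {x \<in> V - {v}. \<tau> x = t} > 0" using N_t[OF v] N2 Nt by simp
          then obtain x where "x \<in> V - {v}" "\<tau> x = t" by (subst (asm) card_gt_0_iff) auto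
          then have "\<tau> v \<in> \<tau> ` (V - {v})" using v by auto
          then show ?thesis by auto
        qed
        have "card (slot_placements V \<tau> E own tgt) =
          (\<Sum>v | v \<in> V \<and> \<tau> v = t. fact (N t - 2) * (m t - 1 + c v) * R)"
          unfolding card_slot_placements_contract[OF fin e0(1)] dom
        proof (rule sum.cong[OF refl], clarify)
          fix v assume v: "v \<in> V" "t = \<tau> v"
          then have v': "v \<in> V" "\<tau> v = t" by auto
          have eq1: "(\<Prod>i\<in>\<tau> ` (V - {v}). fact (card {x \<in> V - {v}. \<tau> x = i} - 1))
            = fact (N t - 2) * (\<Prod>i\<in>\<tau> ` V - {t}. fact (N i - 1) :: nat)"
            unfolding img[OF v']
            by (subst prod.remove[OF _ t(1)])
              (use fin N_t[OF v'] N_other[OF v'(2)] in \<open>auto simp: numeral_2_eq_2\<close>)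
          have eq2: "(\<Prod>i\<in>\<tau> ` (V - {v}) - {0}. card {e \<in> E - {e0}. tgt e = i \<and>
              \<tau> (if own e = v then own e0 else own e) = toward_zero i})
            = (m t - 1 + c v) * (\<Prod>i\<in>\<tau> ` V - {0, t}. m i)"
            unfolding img[OF v'] img0[symmetric] 
            by (subst prod.insert) (use fin m_t[OF v'] m_other[OF v'] in auto)
          have "own e0 \<noteq> v" using e0 v' tz by auto
          then show "card (slot_placements (V - {v}) \<tau> (E - {e0})
            (\<lambda>e. if own e = v then own e0 else own e) tgt) = fact (N (\<tau> v) - 2) * (m (\<tau> v) - 1 + c v) * R"
            using contract[OF e0(1,2) v'] e0(3) unfolding eq1 eq2 R_def v'(2) by (simp add: mult_ac)
        qed
        also have "\<dots> = fact (N t - 2) * (\<Sum>v | v \<in> V \<and> \<tau> v = t. m t - 1 + c v) * R"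
          by (simp add: sum_distrib_left sum_distrib_right)
        also have "(\<Sum>v | v \<in> V \<and> \<tau> v = t. m t - 1 + c v) = N t * (m t - 1) + (N t - m t)"
          using sum_c by (simp add: sum.distrib N_def)
        \<comment> \<open>The truncated differences are exact because
          \<open>0 < m t \<le> N t\<close>.\<close>
        also have "\<dots> = (N t - 1) * m t"
        proof -
          have "m t \<le> N t" using sum_c by simp
          with False Nt show ?thesis
            by (cases "m t"; cases "N t") (auto simp: algebra_simps)
        qed
        also have "fact (N t - 2) * ((N t - 1) * m t) = fact (N t - 1) * m t"
          using N2 Nt by (subst (2) fact_reduce) (auto simp: numeral_2_eq_2)
        finally show ?thesis .
      qed
      then show ?thesis unfolding rhs .
    qed
  qed
qed

section \<open>Labelled trees as slot placements\<close>

text \<open>Only finitely many members are nonempty, which brings the union over a possibly infinite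
  \<open>S\<close> within the convention of \<open>sum'\<close>.\<close>

lemma card_UN_disjoint_sum':
  assumes "\<And>s. s \<in> S \<Longrightarrow> finite (B s)" "\<And>s s'. s \<in> S \<Longrightarrow> s' \<in> S \<Longrightarrow> s \<noteq> s' \<Longrightarrow> B s \<inter> B s' = {}"
    and "finite {s \<in> S. card (B s) \<noteq> 0}"
  shows "card (\<Union>s\<in>S. B s) = sum' (\<lambda>s. card (B s)) S"
proof -
  have "(\<Union>s\<in>S. B s) = (\<Union>s\<in>{s \<in> S. card (B s) \<noteq> 0}. B s)"
  proof -
    have "card (B s) \<noteq> 0 \<longleftrightarrow> B s \<noteq> {}" if "s \<in> S" for s using assms(1)[OF that] by simp
    then show ?thesis by blast
  qed
  also have "card \<dots> = (\<Sum>s\<in>{s \<in> S. card (B s) \<noteq> 0}. card (B s))"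
    by (rule card_UN_disjoint) (use assms in auto)
  finally show ?thesis using assms(3) by (simp add: sum.G_def)
qed

section \<open>Rooted trees as acyclic relations with unique parents\<close>

text \<open>A cycle at v passes through the only parent of v. So a cycle can be pulled back along
  the path from the root to the root itself, which has no parent.\<close>

lemma rooted_tree_acyclic:
  assumes "rooted_tree V r C"
  shows "acyclic C"
proof -
  have C: "C \<subseteq> V \<times> V" "\<And>u. (u, r) \<notin> C" "\<And>v. v \<in> V \<Longrightarrow> (r, v) \<in> C\<^sup>*"
    and parent: "\<And>u u' v. (u, v) \<in> C \<Longrightarrow> (u', v) \<in> C \<Longrightarrow> u = u'"
    using assms unfolding rooted_tree_def by blast+
  have no_cycle: "(v, v) \<notin> C\<^sup>+" if "(r, v) \<in> C\<^sup>*" for v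
    using that
  proof (induction rule: rtrancl_induct)
    case base
    then show ?case using C(2) by (meson tranclE)
  next
    case (step u v)
    show ?case
    proof
      assume "(v, v) \<in> C\<^sup>+"
      then obtain w where "(v, w) \<in> C\<^sup>*" "(w, v) \<in> C" by (meson tranclD2)
      then have "(v, u) \<in> C\<^sup>*" using parent step.hyps by blast
      with step show False by (meson rtrancl_into_trancl2)
    qed
  qed
  show ?thesis unfolding acyclic_def
  proof (intro allI notI)
    fix x assume x: "(x, x) \<in> C\<^sup>+"
    then obtain w where "(w, x) \<in> C" by (meson tranclE)
    then have "x \<in> V" using C(1) by auto
    with x no_cycle C(3) show False by blast
  qed
qed

text \<open>Finiteness and acyclicity give well-foundedness: climbing to parents must stop, and it
  can stop only at r. This yields reachability from r.\<close>

lemma rooted_treeI: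
  assumes "finite C" "acyclic C" "C \<subseteq> V \<times> V" "r \<in> V" "\<And>u. (u, r) \<notin> C"
    and parent: "\<And>v. v \<in> V \<Longrightarrow> v \<noteq> r \<Longrightarrow> \<exists>!u. (u, v) \<in> C"
  shows "rooted_tree V r C"
proof -
  have wf: "wf C" using assms by (intro finite_acyclic_wf)
  have "v \<in> V \<longrightarrow> (r, v) \<in> C\<^sup>*" for v
    using wf
  proof (induction v rule: wf_induct_rule)
    case (less v)
    show ?case
    proof (cases "v = r \<or> v \<notin> V")
      case False
      then obtain u where u: "(u, v) \<in> C" using parent by blast
      then have "u \<in> V" using assms by auto
      with less[OF u] u show ?thesis by (meson rtrancl_into_rtrancl)
    qed auto
  qed
  with assms show ?thesis unfolding rooted_tree_def by blast
qed

section \<open>Trees with prescribed abscissas and their slots\<close>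

text \<open>Fixing the abscissas beforehand makes the targets of all slots known before any child
  relation is chosen.\<close>

definition typed_trees :: "int set \<Rightarrow> (int \<Rightarrow> int \<Rightarrow> nat) \<Rightarrow> nat \<Rightarrow> (nat \<Rightarrow> int) \<Rightarrow> embedded_tree set" where
  "typed_trees S n N \<tau> = {t \<in> injective_cayley_trees S. num_verts t = N \<and> absc t = \<tau> \<and>
     (\<forall>i. \<forall>s\<in>S. card (out_type_vertices t i s) = n i s)}"

text \<open>The pair (u, s) stands for a child of u at abscissa \<open>\<tau> u + s\<close>.
  Injectivity of the tree admits at most one such child, so a set of pairs records everything. A
  slot with owner at i - s will receive a vertex of out-type (i; s).\<close>

definition slot_choices :: "int set \<Rightarrow> (int \<Rightarrow> int \<Rightarrow> nat) \<Rightarrow> 'v set \<Rightarrow> ('v \<Rightarrow> int) \<Rightarrow> ('v \<times> int) set set" where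
  "slot_choices S n V \<tau> =
     {A. A \<subseteq> V \<times> S \<and> (\<forall>i. \<forall>s\<in>S. card {u. (u, s) \<in> A \<and> \<tau> u = i - s} = n i s)}"

definition slot_target :: "('v \<Rightarrow> int) \<Rightarrow> 'v \<times> int \<Rightarrow> int" where
  "slot_target \<tau> = (\<lambda>(u, s). \<tau> u + s)"

text \<open>The description of the root is meaningful only if exactly one vertex fills no slot; for
  the arguments of interest the counts by abscissa guarantee this.\<close>

definition placement_tree :: "nat \<Rightarrow> (nat \<Rightarrow> int) \<Rightarrow> (nat \<times> int) set \<times> (nat \<times> int \<Rightarrow> nat) \<Rightarrow> embedded_tree" where
  "placement_tree N \<tau> = (\<lambda>(A, \<phi>). \<lparr>num_verts = N, root = (THE v. v \<in> {1..N} - \<phi> ` A),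
     child_rel = (\<lambda>e. (fst e, \<phi> e)) ` A, absc = \<tau>\<rparr>)"

lemma card_slot_choice_target:
  assumes A: "A \<in> slot_choices S n V \<tau>" and V: "finite V" and fin: "finite {s \<in> S. n i s \<noteq> 0}"
  shows "card {e \<in> A. slot_target \<tau> e = i} = sum' (n i) S"
proof -
  let ?B = "\<lambda>s. (\<lambda>u. (u, s)) ` {u. (u, s) \<in> A \<and> \<tau> u = i - s}"
  have cardB: "card (?B s) = n i s" if "s \<in> S" for s
    using A that by (subst card_image) (auto simp: inj_on_def slot_choices_def)
  have finB: "finite (?B s)" for s
    using A V by (intro finite_imageI finite_subset[OF _ V]) (auto simp: slot_choices_def)
  have "{e \<in> A. slot_target \<tau> e = i} = (\<Union>s\<in>S. ?B s)"
    using A by (auto simp: slot_choices_def slot_target_def)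
  also have "card \<dots> = sum' (\<lambda>s. card (?B s)) S"
  proof (rule card_UN_disjoint_sum')
    have "{s \<in> S. card (?B s) \<noteq> 0} = {s \<in> S. n i s \<noteq> 0}" using cardB by auto
    with fin show "finite {s \<in> S. card (?B s) \<noteq> 0}" by simp
  qed (use finB in auto)
  also have "\<dots> = sum' (n i) S" using cardB by (rule sum.cong'[OF refl])
  finally show ?thesis .
qed

text \<open>The map \<open>\<phi>\<close> sends the slots (u, s) with owner at i - s bijectively
  onto the vertices of out-type (i; s), because s is the difference of the two abscissas.\<close>

lemma card_out_type_vertices_placement:
  assumes rel: "child_rel t = (\<lambda>e. (fst e, \<phi> e)) ` A" and root: "root t \<notin> \<phi> ` A"
    and V: "\<phi> ` A \<subseteq> vertices t" and inj: "inj_on \<phi> A"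
    and tau: "\<And>e. e \<in> A \<Longrightarrow> absc t (\<phi> e) = slot_target (absc t) e"
  shows "card (out_type_vertices t i s) = card {u. (u, s) \<in> A \<and> absc t u = i - s}"
proof -
  have "out_type_vertices t i s = (\<lambda>u. \<phi> (u, s)) ` {u. (u, s) \<in> A \<and> absc t u = i - s}"
  proof (intro equalityI subsetI)
    fix v assume "v \<in> out_type_vertices t i s"
    then obtain u s' where "absc t v = i" "(u, s') \<in> A" "v = \<phi> (u, s')" "absc t u = i - s"
      unfolding out_type_vertices_def rel by auto
    moreover from this tau[of "(u, s')"] have "s' = s" by (simp add: slot_target_def)
    ultimately show "v \<in> (\<lambda>u. \<phi> (u, s)) ` {u. (u, s) \<in> A \<and> absc t u = i - s}" by auto
  next
    fix v assume "v \<in> (\<lambda>u. \<phi> (u, s)) ` {u. (u, s) \<in> A \<and> absc t u = i - s}"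
    then obtain u where u: "(u, s) \<in> A" "absc t u = i - s" "v = \<phi> (u, s)" by auto
    then have "(u, v) \<in> child_rel t" unfolding rel by force
    moreover have "absc t v = i" using tau[OF u(1)] u by (simp add: slot_target_def)
    moreover have "v \<in> vertices t - {root t}" using u root V by blast
    ultimately show "v \<in> out_type_vertices t i s" unfolding out_type_vertices_def using u(2) by auto
  qed
  moreover have "inj_on (\<lambda>u. \<phi> (u, s)) {u. (u, s) \<in> A \<and> absc t u = i - s}"
    using inj by (auto simp: inj_on_def)
  ultimately show ?thesis by (simp add: card_image)
qed

text \<open>At each abscissa the vertices are as many as the slots aimed there, plus one at 0. Hence
  exactly one vertex is left over, and it has abscissa 0 as a root must.\<close>

lemma placement_tree_in_typed_trees:
  assumes ext: "\<tau> \<in> extensional {1..N}"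
    and profile: "\<And>i. card {v \<in> {1..N}. \<tau> v = i} = vertical_profile S n i"
    and fin: "\<And>i. finite {s \<in> S. n i s \<noteq> 0}"
    and A: "A \<in> slot_choices S n {1..N} \<tau>"
    and \<phi>: "\<phi> \<in> slot_placements {1..N} \<tau> A fst (slot_target \<tau>)"
  shows "placement_tree N \<tau> (A, \<phi>) \<in> typed_trees S n N \<tau>"
proof -
  let ?V = "{1..N}" and ?C = "(\<lambda>e. (fst e, \<phi> e)) ` A"
  have AV: "A \<subseteq> ?V \<times> S" using A by (simp add: slot_choices_def)
  have \<phi>': "\<phi> ` A \<subseteq> ?V" "inj_on \<phi> A" "\<And>e. e \<in> A \<Longrightarrow> \<tau> (\<phi> e) = slot_target \<tau> e" "acyclic ?C"
    using \<phi> by (auto simp: slot_placements_def)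
  have count: "card {v \<in> ?V. \<tau> v = i} = card (\<phi> ` {e \<in> A. slot_target \<tau> e = i}) + (if i = 0 then 1 else 0)" for i
    using card_slot_choice_target[OF A _ fin, of i] profile[of i] \<phi>'(2)
    by (subst card_image) (auto simp: vertical_profile_def intro: inj_on_subset)
  have Vi: "{v \<in> ?V. \<tau> v = i} - \<phi> ` {e \<in> A. slot_target \<tau> e = i} = {v \<in> ?V - \<phi> ` A. \<tau> v = i}" for i
    using \<phi>'(3) by auto
  have sub: "\<phi> ` {e \<in> A. slot_target \<tau> e = i} \<subseteq> {v \<in> ?V. \<tau> v = i}" for i using \<phi>' by auto
  have card_missing: "card {v \<in> ?V - \<phi> ` A. \<tau> v = i} = (if i = 0 then 1 else 0)" for i
    using count[of i] unfolding Vi[symmetric]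
    by (subst card_Diff_subset[OF _ sub]) (auto intro: finite_subset[OF sub])
  then have "{v \<in> ?V - \<phi> ` A. \<tau> v = i} = {}" if "i \<noteq> 0" for i
  proof -
    have "finite {v \<in> ?V - \<phi> ` A. \<tau> v = i}" by simp
    then show ?thesis using card_missing[of i] that by (simp only: if_False card_0_eq)
  qed
  then have missing0: "\<tau> v = 0" if "v \<in> ?V - \<phi> ` A" for v using that by blast
  then have "{v \<in> ?V - \<phi> ` A. \<tau> v = 0} = ?V - \<phi> ` A" by auto
  with card_missing[of 0] obtain r where r: "?V - \<phi> ` A = {r}" by (auto simp: card_1_singleton_iff)
  define t where "t = placement_tree N \<tau> (A, \<phi>)"
  have "(THE v. v \<in> ?V - \<phi> ` A) = r" unfolding r by auto
  then have t: "num_verts t = N" "root t = r" "child_rel t = ?C" "absc t = \<tau>" "vertices t = ?V"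
    by (simp_all add: t_def placement_tree_def vertices_def)
  have finA: "finite A"
  proof -
    have "finite (\<phi> ` A)" using \<phi>'(1) by (rule finite_subset) simp
    then show ?thesis using \<phi>'(2) by (simp add: finite_image_iff)
  qed
  have r': "r \<in> ?V" "r \<notin> \<phi> ` A" using r by blast+
  have parent: "e = e'" if "e \<in> A" "e' \<in> A" "\<phi> e = \<phi> e'" for e e'
    using that \<phi>'(2) by (auto simp: inj_on_def)
  have "rooted_tree ?V r ?C"
  proof (rule rooted_treeI)
    show "\<exists>!u. (u, v) \<in> ?C" if v: "v \<in> ?V" "v \<noteq> r" for v
    proof -
      obtain e where e: "e \<in> A" "v = \<phi> e" using v r by blast
      then have "(fst e, v) \<in> ?C" by blast
      then show ?thesis using e parent by blast
    qed
  qed (use finA \<phi>' AV r' in auto)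
  moreover have "\<tau> v' - \<tau> v \<in> S" if "(v, v') \<in> ?C" for v v'
    using that AV \<phi>'(3) by (auto simp: slot_target_def)
  moreover have "\<exists>\<^sub>\<le>\<^sub>1 v'. (v, v') \<in> ?C \<and> \<tau> v' = \<tau> v + s" for v s
    using \<phi>'(3) by (auto simp: slot_target_def Uniq_def)
  moreover have "\<tau> r = 0" using missing0 r by blast
  moreover have "card (out_type_vertices t i s) = n i s" if "s \<in> S" for i s
    using card_out_type_vertices_placement[of t \<phi> A i s] t r' \<phi>' A that by (simp add: slot_choices_def)
  ultimately show "placement_tree N \<tau> (A, \<phi>) \<in> typed_trees S n N \<tau>"
    unfolding t_def[symmetric] typed_trees_def injective_cayley_trees_def embedded_cayley_tree_def
      injective_tree_def using ext by (auto simp: t)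
qed

text \<open>The child relation remembers the slots: an edge (u, v) can only come from the slot
  \<open>(u, \<tau> v - \<tau> u)\<close>.\<close>

lemma inj_on_placement_tree:
  "inj_on (placement_tree N \<tau>)
     (SIGMA A : slot_choices S n {1..N} \<tau>. slot_placements {1..N} \<tau> A fst (slot_target \<tau>))"
proof (rule inj_onI, clarify)
  fix A \<phi> A' \<phi>'
  assume A: "A \<in> slot_choices S n {1..N} \<tau>" "A' \<in> slot_choices S n {1..N} \<tau>"
    and \<phi>: "\<phi> \<in> slot_placements {1..N} \<tau> A fst (slot_target \<tau>)"
    and \<phi>': "\<phi>' \<in> slot_placements {1..N} \<tau> A' fst (slot_target \<tau>)"
    and eq: "placement_tree N \<tau> (A, \<phi>) = placement_tree N \<tau> (A', \<phi>')"
  have rel: "(\<lambda>e. (fst e, \<phi> e)) ` A = (\<lambda>e. (fst e, \<phi>' e)) ` A'"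
    using eq by (simp add: placement_tree_def)
  have tau: "\<And>e. e \<in> A \<Longrightarrow> \<tau> (\<phi> e) = \<tau> (fst e) + snd e" "\<And>e. e \<in> A' \<Longrightarrow> \<tau> (\<phi>' e) = \<tau> (fst e) + snd e"
    using \<phi> \<phi>' by (auto simp: slot_placements_def slot_target_def)
  have 1: "e \<in> A' \<and> \<phi> e = \<phi>' e" if e: "e \<in> A" for e
  proof -
    from e rel obtain e' where e': "e' \<in> A'" "fst e = fst e'" "\<phi> e = \<phi>' e'" by blast
    with tau(1)[OF e] tau(2)[OF e'(1)] have "e = e'" by (simp add: prod_eq_iff)
    with e' show ?thesis by simp
  qed
  have 2: "e \<in> A" if e: "e \<in> A'" for e
  proof -
    from e rel obtain e' where e': "e' \<in> A" "fst e = fst e'" "\<phi>' e = \<phi> e'" by blast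
    with tau(1)[OF e'(1)] tau(2)[OF e] have "e = e'" by (simp add: prod_eq_iff)
    with e' show ?thesis by simp
  qed
  have "A = A'" using 1 2 by blast
  moreover have "\<phi> = \<phi>'"
  proof (rule extensionalityI)
    show "\<phi> \<in> extensional A" "\<phi>' \<in> extensional A"
      using \<phi> \<phi>' \<open>A = A'\<close> by (auto simp: slot_placements_def PiE_def)
  qed (use 1 in auto)
  ultimately show "A = A' \<and> \<phi> = \<phi>'" by simp
qed

text \<open>Reading an edge (u, v) as the slot \<open>(u, \<tau> v - \<tau> u)\<close> filled by v
  inverts the construction; injectivity of the tree is what makes the \<open>THE\<close> in
  \<open>\<phi>\<close> well-defined.\<close>

lemma typed_trees_subset_placement_trees:
  "typed_trees S n N \<tau> \<subseteq> placement_tree N \<tau> `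
     (SIGMA A : slot_choices S n {1..N} \<tau>. slot_placements {1..N} \<tau> A fst (slot_target \<tau>))"
proof
  fix t assume t: "t \<in> typed_trees S n N \<tau>"
  let ?V = "{1..N}"
  define C where "C = child_rel t"
  have t': "num_verts t = N" "absc t = \<tau>" "vertices t = ?V"
    and tree: "rooted_tree ?V (root t) C"
    and S: "\<And>u v. (u, v) \<in> C \<Longrightarrow> \<tau> v - \<tau> u \<in> S"
    and inj: "\<And>u s. u \<in> ?V \<Longrightarrow> s \<in> S \<Longrightarrow> \<exists>\<^sub>\<le>\<^sub>1 v. (u, v) \<in> C \<and> \<tau> v = \<tau> u + s"
    and out: "\<And>i s. s \<in> S \<Longrightarrow> card (out_type_vertices t i s) = n i s"
    using t unfolding typed_trees_def injective_cayley_trees_def embedded_cayley_tree_def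
      injective_tree_def C_def by (auto simp: vertices_def)
  have C: "C \<subseteq> ?V \<times> ?V" "\<And>u. (u, root t) \<notin> C" "root t \<in> ?V"
    and parent: "\<And>u u' v. (u, v) \<in> C \<Longrightarrow> (u', v) \<in> C \<Longrightarrow> u = u'"
    and has_parent: "\<And>v. v \<in> ?V \<Longrightarrow> v \<noteq> root t \<Longrightarrow> \<exists>u. (u, v) \<in> C"
    using tree unfolding rooted_tree_def by blast+
  define A where "A = (\<lambda>(u, v). (u, \<tau> v - \<tau> u)) ` C"
  define \<phi> where "\<phi> = restrict (\<lambda>(u, s). THE v. (u, v) \<in> C \<and> \<tau> v = \<tau> u + s) A"
  have \<phi>_eq: "\<phi> (u, \<tau> v - \<tau> u) = v" if uv: "(u, v) \<in> C" for u v
  proof -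
    have "(u, \<tau> v - \<tau> u) \<in> A" using uv unfolding A_def by force
    moreover have "(THE w. (u, w) \<in> C \<and> \<tau> w = \<tau> u + (\<tau> v - \<tau> u)) = v"
      using inj[of u "\<tau> v - \<tau> u"] uv S[OF uv] C(1) by (intro the1_equality') auto
    ultimately show ?thesis by (simp add: \<phi>_def)
  qed
  have rel: "(\<lambda>e. (fst e, \<phi> e)) ` A = C"
  proof -
    have "(\<lambda>e. (fst e, \<phi> e)) ` A = (\<lambda>(u, v). (u, \<phi> (u, \<tau> v - \<tau> u))) ` C"
      unfolding A_def image_image by (simp add: split_beta)
    also have "\<dots> = (\<lambda>x. x) ` C" using \<phi>_eq by (intro image_cong) auto
    finally show ?thesis by simp
  qed
  have img: "\<phi> ` A = snd ` C" by (subst rel[symmetric]) (simp add: image_image)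
  have \<phi>_typ: "\<tau> (\<phi> e) = slot_target \<tau> e" if "e \<in> A" for e
    using that \<phi>_eq by (auto simp: A_def slot_target_def)
  have \<phi>_inj: "inj_on \<phi> A"
  proof (rule inj_onI)
    fix e e' assume e: "e \<in> A" "e' \<in> A" "\<phi> e = \<phi> e'"
    then obtain u v u' v' where uv: "(u, v) \<in> C" "e = (u, \<tau> v - \<tau> u)" "(u', v') \<in> C" "e' = (u', \<tau> v' - \<tau> u')"
      by (auto simp: A_def)
    with e \<phi>_eq have "v = v'" by auto
    with uv parent show "e = e'" by blast
  qed
  have root: "root t \<notin> \<phi> ` A" using C(2) unfolding img by auto
  have sub: "\<phi> ` A \<subseteq> ?V" using C(1) unfolding img by auto
  have missing: "?V - \<phi> ` A = {root t}"
    using root C(3) has_parent unfolding img by (force simp: image_iff)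
  have "A \<in> slot_choices S n ?V \<tau>"
  proof -
    have "A \<subseteq> ?V \<times> S" using C(1) S by (auto simp: A_def)
    moreover have "card {u. (u, s) \<in> A \<and> \<tau> u = i - s} = n i s" if "s \<in> S" for i s
      using card_out_type_vertices_placement[of t \<phi> A i s] rel root sub \<phi>_inj \<phi>_typ out[OF that]
      by (simp add: t' C_def)
    ultimately show ?thesis by (simp add: slot_choices_def)
  qed
  moreover have "\<phi> \<in> slot_placements ?V \<tau> A fst (slot_target \<tau>)"
    unfolding slot_placements_def mem_Collect_eq rel
    using rooted_tree_acyclic[OF tree] \<phi>_inj \<phi>_typ sub by (auto simp: \<phi>_def)
  moreover have "t = placement_tree N \<tau> (A, \<phi>)"
    unfolding placement_tree_def prod.case missing rel using t' by (intro embedded_tree.equality) (auto simp: C_def)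
  ultimately show "t \<in> placement_tree N \<tau> `
      (SIGMA A : slot_choices S n ?V \<tau>. slot_placements ?V \<tau> A fst (slot_target \<tau>))"
    by blast
qed

lemma bij_betw_placement_tree:
  assumes "\<tau> \<in> extensional {1..N}"
    and "\<And>i. card {v \<in> {1..N}. \<tau> v = i} = vertical_profile S n i"
    and "\<And>i. finite {s \<in> S. n i s \<noteq> 0}"
  shows "bij_betw (placement_tree N \<tau>)
     (SIGMA A : slot_choices S n {1..N} \<tau>. slot_placements {1..N} \<tau> A fst (slot_target \<tau>))
     (typed_trees S n N \<tau>)"
  unfolding bij_betw_def
proof (intro conjI equalityI inj_on_placement_tree typed_trees_subset_placement_trees)
  show "placement_tree N \<tau> ` (SIGMA A : slot_choices S n {1..N} \<tau>.
      slot_placements {1..N} \<tau> A fst (slot_target \<tau>)) \<subseteq> typed_trees S n N \<tau>"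
    by (rule image_subsetI) (auto intro: placement_tree_in_typed_trees[OF assms])
qed

section \<open>Trees equivalent to a given tree\<close>

lemma card_eq_if_fibres_eq:
  assumes "finite A" "finite B" "\<And>i. card {x \<in> A. a x = i} = card {y \<in> B. b y = i}"
  shows "card A = card B"
proof -
  let ?I = "a ` A \<union> b ` B"
  have "card A = (\<Sum>i\<in>?I. card {x \<in> A. a x = i})"
    using assms(1,2) by (subst card_UN_disjoint[symmetric]) (auto intro!: arg_cong[of _ _ card])
  also have "\<dots> = (\<Sum>i\<in>?I. card {y \<in> B. b y = i})" using assms(3) by simp
  also have "\<dots> = card B"
    using assms(1,2) by (subst card_UN_disjoint[symmetric]) (auto intro!: arg_cong[of _ _ card])
  finally show ?thesis .
qed

text \<open>Induction on \<open>A\<close>: the new element has as many images as its fibre in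
  \<open>B\<close> has elements, and deleting the chosen image keeps the fibres on both sides
  equinumerous.\<close>

lemma card_type_preserving_injections:
  assumes "finite A" "finite B" "finite I" "a ` A \<subseteq> I"
    and "\<And>i. card {x \<in> A. a x = i} = card {y \<in> B. b y = i}"
  shows "card {f \<in> A \<rightarrow>\<^sub>E B. inj_on f A \<and> (\<forall>x\<in>A. b (f x) = a x)} =
    (\<Prod>i\<in>I. fact (card {y \<in> B. b y = i}))"
  using assms
proof (induction A arbitrary: B rule: finite_induct)
  case empty
  have "card {y \<in> B. b y = i} = 0" for i using empty.prems(4)[of i] by simp
  then have "(\<Prod>i\<in>I. fact (card {y \<in> B. b y = i})) = (\<Prod>i\<in>I. fact 0 :: nat)" by (simp only:)
  then show ?case by simp
next
  case (insert x A)
  let ?P = "\<lambda>f. inj_on f (insert x A) \<and> (\<forall>z\<in>insert x A. b (f z) = a z)"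
  let ?F = "\<lambda>B. {f \<in> A \<rightarrow>\<^sub>E B. inj_on f A \<and> (\<forall>z\<in>A. b (f z) = a z)}"
  let ?W = "{w \<in> B. b w = a x}"
  let ?R = "\<Prod>i\<in>I - {a x}. fact (card {y \<in> B. b y = i}) :: nat"
  have ax: "a x \<in> I" using insert.prems by auto
  have ins: "{z \<in> insert x A. a z = a x} = insert x {z \<in> A. a z = a x}" by auto
  have W: "card ?W = Suc (card {z \<in> A. a z = a x})"
    using insert.hyps insert.prems(4)[of "a x", symmetric] unfolding ins by simp
  have "card {f \<in> insert x A \<rightarrow>\<^sub>E B. ?P f} = (\<Sum>w\<in>B. card {f \<in> A \<rightarrow>\<^sub>E B. ?P (f(x := w))})"
    by (rule card_PiE_insert_split) (use insert in auto)
  also have "\<dots> = (\<Sum>w\<in>?W. card {f \<in> A \<rightarrow>\<^sub>E B. ?P (f(x := w))})"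
  proof (rule sum.mono_neutral_right)
    show "\<forall>w\<in>B - ?W. card {f \<in> A \<rightarrow>\<^sub>E B. ?P (f(x := w))} = 0"
    proof
      fix w assume "w \<in> B - ?W"
      then have "{f \<in> A \<rightarrow>\<^sub>E B. ?P (f(x := w))} = {}" by auto
      then show "card {f \<in> A \<rightarrow>\<^sub>E B. ?P (f(x := w))} = 0" by (simp only: card.empty)
    qed
  qed (use insert.prems in auto)
  also have "\<dots> = (\<Sum>w\<in>?W. fact (card ?W - 1) * ?R)"
  proof (rule sum.cong[OF refl])
    fix w assume w: "w \<in> ?W"
    have "{f \<in> A \<rightarrow>\<^sub>E B. ?P (f(x := w))} = ?F (B - {w})"
    proof (intro set_eqI)
      fix f
      have "inj_on (f(x := w)) (insert x A) \<longleftrightarrow> inj_on f A \<and> w \<notin> f ` A"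
        using insert.hyps(2) by (auto simp: inj_on_def image_iff)
      moreover have "(\<forall>z\<in>insert x A. b ((f(x := w)) z) = a z) \<longleftrightarrow> (\<forall>z\<in>A. b (f z) = a z)"
        using insert.hyps(2) w by auto
      moreover have "f \<in> A \<rightarrow>\<^sub>E B \<and> w \<notin> f ` A \<longleftrightarrow> f \<in> A \<rightarrow>\<^sub>E (B - {w})"
        by (auto simp: PiE_iff)
      ultimately show "f \<in> {f \<in> A \<rightarrow>\<^sub>E B. ?P (f(x := w))} \<longleftrightarrow> f \<in> ?F (B - {w})"
        unfolding mem_Collect_eq by blast
    qed
    moreover have same: "card {y \<in> B - {w}. b y = a x} = card ?W - 1"
    proof -
      have "{y \<in> B - {w}. b y = a x} = ?W - {w}" by auto
      then show ?thesis using w insert.prems(1) by (simp add: card_Diff_singleton)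
    qed
    moreover have other: "card {y \<in> B - {w}. b y = i} = card {y \<in> B. b y = i}" if "i \<noteq> a x" for i
      by (rule arg_cong[of _ _ card]) (use that w in auto)
    moreover have "card (?F (B - {w})) = (\<Prod>i\<in>I. fact (card {y \<in> B - {w}. b y = i}))"
    proof (rule insert.IH)
      show "card {z \<in> A. a z = i} = card {y \<in> B - {w}. b y = i}" for i
      proof (cases "i = a x")
        case True
        then show ?thesis using same W by simp
      next
        case False
        then have "{z \<in> insert x A. a z = i} = {z \<in> A. a z = i}" by auto
        then show ?thesis using insert.prems(4)[of i] other[OF False] by simp
      qed
    qed (use insert.prems in auto)
    moreover have "(\<Prod>i\<in>I. fact (card {y \<in> B - {w}. b y = i})) = fact (card ?W - 1) * ?R"
      using same other insert.prems(2) ax by (subst prod.remove[OF _ ax]) auto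
    ultimately show "card {f \<in> A \<rightarrow>\<^sub>E B. ?P (f(x := w))} = fact (card ?W - 1) * ?R" by simp
  qed
  also have "\<dots> = fact (card ?W) * ?R" using W by (simp add: algebra_simps)
  also have "\<dots> = (\<Prod>i\<in>I. fact (card {y \<in> B. b y = i}))"
    using insert.prems(2) ax by (simp add: prod.remove[OF _ ax])
  finally show ?case .
qed

text \<open>A non-root vertex has a unique parent and thus exactly one out-type; the root accounts
  for the extra 1 at abscissa 0. So the out-types determine the abscissa counts of every
  representative.\<close>

lemma card_abscissa_eq_vertical_profile:
  assumes t: "embedded_cayley_tree S t"
    and out: "\<And>i s. s \<in> S \<Longrightarrow> card (out_type_vertices t i s) = n i s"
    and fin: "\<And>i. finite {s \<in> S. n i s \<noteq> 0}"
  shows "card {v \<in> vertices t. absc t v = i} = vertical_profile S n i"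
proof -
  have tree: "rooted_tree (vertices t) (root t) (child_rel t)" and root: "absc t (root t) = 0"
    and S: "\<And>u v. (u, v) \<in> child_rel t \<Longrightarrow> absc t v - absc t u \<in> S"
    using t unfolding embedded_cayley_tree_def by auto
  have rootV: "root t \<in> vertices t"
    and parent: "\<And>u u' v. (u, v) \<in> child_rel t \<Longrightarrow> (u', v) \<in> child_rel t \<Longrightarrow> u = u'"
    and has_parent: "\<And>v. v \<in> vertices t \<Longrightarrow> v \<noteq> root t \<Longrightarrow> \<exists>u. (u, v) \<in> child_rel t"
    using tree unfolding rooted_tree_def by blast+
  have finV: "finite (vertices t)" by (simp add: vertices_def)
  let ?R = "{v \<in> {root t}. i = 0}"
  have "{v \<in> vertices t. absc t v = i} = (\<Union>s\<in>S. out_type_vertices t i s) \<union> ?R"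
  proof (intro equalityI subsetI)
    fix v assume v: "v \<in> {v \<in> vertices t. absc t v = i}"
    show "v \<in> (\<Union>s\<in>S. out_type_vertices t i s) \<union> ?R"
    proof (cases "v = root t")
      case False
      with v obtain u where u: "(u, v) \<in> child_rel t" using has_parent by auto
      then have "v \<in> out_type_vertices t i (absc t v - absc t u)"
        using v False by (auto simp: out_type_vertices_def)
      with S[OF u] show ?thesis by blast
    qed (use v root in auto)
  qed (use rootV root in \<open>auto simp: out_type_vertices_def\<close>)
  also have "card \<dots> = card (\<Union>s\<in>S. out_type_vertices t i s) + card ?R"
    by (rule card_Un_disjoint) (auto simp: out_type_vertices_def intro: finite_subset[OF _ finV])
  also have "card (\<Union>s\<in>S. out_type_vertices t i s) = sum' (\<lambda>s. card (out_type_vertices t i s)) S"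
  proof (rule card_UN_disjoint_sum')
    show "finite (out_type_vertices t i s)" for s
      by (rule finite_subset[OF _ finV]) (auto simp: out_type_vertices_def)
    show "out_type_vertices t i s \<inter> out_type_vertices t i s' = {}" if "s \<noteq> s'" for s s'
      using parent that by (fastforce simp: out_type_vertices_def)
    have "{s \<in> S. card (out_type_vertices t i s) \<noteq> 0} = {s \<in> S. n i s \<noteq> 0}" using out by auto
    then show "finite {s \<in> S. card (out_type_vertices t i s) \<noteq> 0}" using fin by simp
  qed
  also have "\<dots> = sum' (n i) S" using out by (rule sum.cong'[OF refl])
  finally show ?thesis by (auto simp: vertical_profile_def)
qed

section \<open>Transport of trees along bijections\<close>

lemma map_prod_image_mem_iff:
  assumes "inj_on f V" "C \<subseteq> V \<times> V" "u \<in> V" "v \<in> V"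
  shows "(f u, f v) \<in> map_prod f f ` C \<longleftrightarrow> (u, v) \<in> C"
  using inj_on_image_mem_iff[OF map_prod_inj_on[OF assms(1,1)], of "(u, v)" C] assms by simp

lemma rooted_tree_image:
  assumes tree: "rooted_tree V r C" and f: "bij_betw f V W"
  shows "rooted_tree W (f r) (map_prod f f ` C)"
proof -
  have C: "r \<in> V" "C \<subseteq> V \<times> V" "\<And>u. (u, r) \<notin> C" "\<And>v. v \<in> V \<Longrightarrow> (r, v) \<in> C\<^sup>*"
    "\<And>v. v \<in> V \<Longrightarrow> v \<noteq> r \<Longrightarrow> \<exists>!u. (u, v) \<in> C"
    using tree unfolding rooted_tree_def by auto
  have W: "W = f ` V" using f by (simp add: bij_betw_def)
  have reach: "(f r, f v) \<in> (map_prod f f ` C)\<^sup>*" if "(r, v) \<in> C\<^sup>*" for v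
    using that
  proof (induction rule: rtrancl_induct)
    case (step u v)
    then have "(f u, f v) \<in> map_prod f f ` C" by force
    with step.IH show ?case by (rule rtrancl_into_rtrancl)
  qed simp
  have edge: "(f u, f v) \<in> map_prod f f ` C \<longleftrightarrow> (u, v) \<in> C" if "u \<in> V" "v \<in> V" for u v
    using map_prod_image_mem_iff[OF bij_betw_imp_inj_on[OF f] C(2) that] .
  have edgeV: "\<exists>u'\<in>V. u = f u'" if "(u, w) \<in> map_prod f f ` C" for u w
    using that C(2) by auto
  have parent: "\<exists>!u. (u, f v) \<in> map_prod f f ` C" if v: "v \<in> V" "f v \<noteq> f r" for v
  proof -
    have "v \<noteq> r" using v by auto
    then obtain u where u: "(u, v) \<in> C" "\<And>u'. (u', v) \<in> C \<Longrightarrow> u' = u" using C(5)[OF v(1)] by blast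
    show ?thesis
    proof (rule ex1I[of _ "f u"])
      show "(f u, f v) \<in> map_prod f f ` C" using u(1) by (intro image_eqI[of _ _ "(u, v)"]) auto
      show "u' = f u" if u': "(u', f v) \<in> map_prod f f ` C" for u'
      proof -
        obtain w where w: "w \<in> V" "u' = f w" using edgeV[OF u'] by blast
        with u' edge[OF w(1) v(1)] have "(w, v) \<in> C" by simp
        with u(2) w show ?thesis by simp
      qed
    qed
  qed
  have root: "(u, f r) \<notin> map_prod f f ` C" for u
  proof
    assume u: "(u, f r) \<in> map_prod f f ` C"
    obtain w where w: "w \<in> V" "u = f w" using edgeV[OF u] by blast
    with u edge[OF w(1) C(1)] C(3) show False by simp
  qed
  show ?thesis unfolding rooted_tree_def W
  proof (intro conjI ballI allI)
    show "map_prod f f ` C \<subseteq> f ` V \<times> f ` V" using C(2) by auto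
    show "\<exists>!u. (u, w) \<in> map_prod f f ` C" if w: "w \<in> f ` V - {f r}" for w
    proof -
      obtain v where v: "w = f v" "v \<in> V" using w by blast
      then show ?thesis using parent[of v] w by simp
    qed
    show "(f r, w) \<in> (map_prod f f ` C)\<^sup>*" if w: "w \<in> f ` V" for w
    proof -
      obtain v where v: "w = f v" "v \<in> V" using w by blast
      then show ?thesis using reach C(4) by simp
    qed
  qed (use C(1) root in simp_all)
qed

text \<open>Roots are not mentioned in \<open>tree_equiv\<close>, but the root is the only vertex
  without a parent, so an equivalence carries root to root.\<close>

lemma tree_equivE:
  assumes t: "embedded_cayley_tree S t" "embedded_cayley_tree S' t'" and eqv: "tree_equiv t t'"
  obtains f where "bij_betw f (vertices t) (vertices t')" "root t' = f (root t)"
    "child_rel t' = map_prod f f ` child_rel t" "\<And>v. v \<in> vertices t \<Longrightarrow> absc t' (f v) = absc t v"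
proof -
  obtain f where f: "bij_betw f (vertices t) (vertices t')"
    "\<And>u v. u \<in> vertices t \<Longrightarrow> v \<in> vertices t \<Longrightarrow> (u, v) \<in> child_rel t \<longleftrightarrow> (f u, f v) \<in> child_rel t'"
    "\<And>v. v \<in> vertices t \<Longrightarrow> absc t' (f v) = absc t v"
    using eqv unfolding tree_equiv_def by blast
  have T: "rooted_tree (vertices t) (root t) (child_rel t)" "rooted_tree (vertices t') (root t') (child_rel t')"
    using t unfolding embedded_cayley_tree_def by auto
  have C: "child_rel t \<subseteq> vertices t \<times> vertices t" "child_rel t' \<subseteq> vertices t' \<times> vertices t'"
    using T unfolding rooted_tree_def by auto
  have W: "vertices t' = f ` vertices t" using f(1) by (simp add: bij_betw_def)
  have rel: "child_rel t' = map_prod f f ` child_rel t"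
  proof (intro equalityI subsetI)
    fix e assume e: "e \<in> child_rel t'"
    then obtain u v where uv: "e = (f u, f v)" "u \<in> vertices t" "v \<in> vertices t"
      using C(2) unfolding W by blast
    with e f(2) have "(u, v) \<in> child_rel t" by simp
    then show "e \<in> map_prod f f ` child_rel t" using uv by force
  qed (use f(2) C(1) in auto)
  have "rooted_tree (vertices t') (f (root t)) (child_rel t')"
    unfolding rel by (rule rooted_tree_image[OF T(1) f(1)])
  with T(2) have "root t' = f (root t)" unfolding rooted_tree_def by (metis DiffI singletonD)
  with f rel that show thesis by blast
qed

lemma tree_equiv_card_out_type_vertices:
  assumes t: "embedded_cayley_tree S t" "embedded_cayley_tree S t'" and eqv: "tree_equiv t t'"
  shows "card (out_type_vertices t i s) = card (out_type_vertices t' i s)"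
proof -
  have le: "card (out_type_vertices t i s) \<le> card (out_type_vertices t' i s)"
    if t: "embedded_cayley_tree S t" "embedded_cayley_tree S t'" and eqv: "tree_equiv t t'" for t t'
  proof -
    obtain f where f: "bij_betw f (vertices t) (vertices t')" "root t' = f (root t)"
      "child_rel t' = map_prod f f ` child_rel t" "\<And>v. v \<in> vertices t \<Longrightarrow> absc t' (f v) = absc t v"
      using tree_equivE[OF t eqv] by blast
    have T: "child_rel t \<subseteq> vertices t \<times> vertices t" "root t \<in> vertices t"
      using t(1) unfolding embedded_cayley_tree_def rooted_tree_def by auto
    have inj: "inj_on f (vertices t)" and W: "vertices t' = f ` vertices t"
      using f(1) by (auto simp: bij_betw_def)
    have "f v \<in> out_type_vertices t' i s" if "v \<in> out_type_vertices t i s" for v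
    proof -
      from that obtain u where u: "v \<in> vertices t" "v \<noteq> root t" "absc t v = i" "(u, v) \<in> child_rel t"
        "absc t u = i - s" unfolding out_type_vertices_def by auto
      have "u \<in> vertices t" using u T by auto
      moreover have "(f u, f v) \<in> child_rel t'" unfolding f(3) using u(4) by force
      moreover have "f v \<noteq> root t'" using u T inj unfolding f(2) by (auto simp: inj_on_def)
      ultimately show ?thesis using u f(4) W unfolding out_type_vertices_def by auto
    qed
    then show ?thesis
      by (intro card_inj_on_le[of f])
        (auto simp: out_type_vertices_def vertices_def intro: inj_on_subset[OF inj])
  qed
  show ?thesis using le[OF t eqv] le[OF t(2,1) tree_equiv_sym[OF eqv]] by simp
qed

section \<open>Relabellings and the number of representatives\<close>

text \<open>The abscissas are prescribed rather than transported along f. Both agree on the vertices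
  when \<open>\<tau> (f v) = absc t v\<close>, and a prescribed \<open>\<tau>\<close> can be taken
  extensional.\<close>

definition relabel :: "(nat \<Rightarrow> int) \<Rightarrow> embedded_tree \<Rightarrow> (nat \<Rightarrow> nat) \<Rightarrow> embedded_tree" where
  "relabel \<tau> t f = \<lparr>num_verts = num_verts t, root = f (root t),
     child_rel = map_prod f f ` child_rel t, absc = \<tau>\<rparr>"

lemma relabel_tree:
  assumes t: "t \<in> injective_cayley_trees S" and ext: "\<tau> \<in> extensional (vertices t)"
    and f: "bij_betw f (vertices t) (vertices t)" "\<And>v. v \<in> vertices t \<Longrightarrow> \<tau> (f v) = absc t v"
  shows "relabel \<tau> t f \<in> injective_cayley_trees S" "tree_equiv t (relabel \<tau> t f)"
proof -
  let ?V = "vertices t" and ?C = "child_rel t"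
  have tree: "rooted_tree ?V (root t) ?C" and root: "absc t (root t) = 0"
    and S: "\<And>u v. (u, v) \<in> ?C \<Longrightarrow> absc t v - absc t u \<in> S"
    and injt: "\<And>u s. u \<in> ?V \<Longrightarrow> s \<in> S \<Longrightarrow> \<exists>\<^sub>\<le>\<^sub>1 v. (u, v) \<in> ?C \<and> absc t v = absc t u + s"
    using t unfolding injective_cayley_trees_def embedded_cayley_tree_def injective_tree_def by auto
  have C: "?C \<subseteq> ?V \<times> ?V" "root t \<in> ?V" using tree unfolding rooted_tree_def by auto
  have W: "?V = f ` ?V" using f(1) by (simp add: bij_betw_def)
  have r: "vertices (relabel \<tau> t f) = ?V" "root (relabel \<tau> t f) = f (root t)"
    "child_rel (relabel \<tau> t f) = map_prod f f ` ?C" "absc (relabel \<tau> t f) = \<tau>"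
    by (simp_all add: relabel_def vertices_def)
  have edge: "(f u, f v) \<in> map_prod f f ` ?C \<longleftrightarrow> (u, v) \<in> ?C" if "u \<in> ?V" "v \<in> ?V" for u v
    using map_prod_image_mem_iff[OF bij_betw_imp_inj_on[OF f(1)] C(1) that] .
  have "embedded_cayley_tree S (relabel \<tau> t f)"
    unfolding embedded_cayley_tree_def r
    using rooted_tree_image[OF tree f(1)] ext f(2) root C S by force
  moreover have "injective_tree S (relabel \<tau> t f)"
    unfolding injective_tree_def r
  proof (intro ballI)
    fix v s assume v: "v \<in> ?V" and s: "s \<in> S"
    obtain u where u: "u \<in> ?V" "v = f u" using v W by blast
    show "\<exists>\<^sub>\<le>\<^sub>1 v'. (v, v') \<in> map_prod f f ` ?C \<and> \<tau> v' = \<tau> v + s"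
    proof (rule Uniq_I)
      fix x y
      assume x: "(v, x) \<in> map_prod f f ` ?C \<and> \<tau> x = \<tau> v + s"
        and y: "(v, y) \<in> map_prod f f ` ?C \<and> \<tau> y = \<tau> v + s"
      obtain x' y' where xy: "x' \<in> ?V" "y' \<in> ?V" "x = f x'" "y = f y'"
        using x y C(1) by auto
      have "x' = y'"
        by (rule Uniq_D[OF injt[OF u(1) s]]) (use x y xy u edge f(2) in auto)
      then show "y = x" using xy by simp
    qed
  qed
  ultimately show "relabel \<tau> t f \<in> injective_cayley_trees S" by (simp add: injective_cayley_trees_def)
  show "tree_equiv t (relabel \<tau> t f)"
    unfolding tree_equiv_def r using f edge by (intro exI[of _ f]) auto
qed

text \<open>Injective trees are rigid: the image of a vertex determines the images of its children.\<close>

lemma inj_on_relabel: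
  assumes t: "t \<in> injective_cayley_trees S" and ext: "\<tau> \<in> extensional (vertices t)"
  shows "inj_on (relabel \<tau> t)
    {f \<in> vertices t \<rightarrow>\<^sub>E vertices t. bij_betw f (vertices t) (vertices t) \<and> (\<forall>v\<in>vertices t. \<tau> (f v) = absc t v)}"
proof (rule inj_onI, clarify)
  let ?V = "vertices t" and ?C = "child_rel t"
  fix f g
  assume f: "f \<in> ?V \<rightarrow>\<^sub>E ?V" "bij_betw f ?V ?V" "\<forall>v\<in>?V. \<tau> (f v) = absc t v"
    and g: "g \<in> ?V \<rightarrow>\<^sub>E ?V" "bij_betw g ?V ?V" "\<forall>v\<in>?V. \<tau> (g v) = absc t v"
    and eq: "relabel \<tau> t f = relabel \<tau> t g"
  have tree: "rooted_tree ?V (root t) ?C" and S: "\<And>u v. (u, v) \<in> ?C \<Longrightarrow> absc t v - absc t u \<in> S"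
    using t unfolding injective_cayley_trees_def embedded_cayley_tree_def by auto
  have C: "?C \<subseteq> ?V \<times> ?V" "\<And>v. v \<in> ?V \<Longrightarrow> (root t, v) \<in> ?C\<^sup>*" using tree unfolding rooted_tree_def by auto
  have rel: "map_prod f f ` ?C = map_prod g g ` ?C" and root: "f (root t) = g (root t)"
    using eq by (auto simp: relabel_def)
  have inj: "\<exists>\<^sub>\<le>\<^sub>1 v'. (v, v') \<in> map_prod f f ` ?C \<and> \<tau> v' = \<tau> v + s" if "v \<in> ?V" "s \<in> S" for v s
    using relabel_tree(1)[OF t ext f(2)] f(3) that
    by (auto simp: injective_cayley_trees_def injective_tree_def relabel_def vertices_def)
  have "f v = g v" if "(root t, v) \<in> ?C\<^sup>*" for v
    using that
  proof (induction rule: rtrancl_induct)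
    case (step u v)
    have uv: "u \<in> ?V" "v \<in> ?V" using step.hyps C by auto
    have fu: "f u \<in> ?V" using f(1) uv by auto
    have 1: "(f u, f v) \<in> map_prod f f ` ?C" using step.hyps by force
    have "(g u, g v) \<in> map_prod g g ` ?C" using step.hyps by force
    then have 2: "(f u, g v) \<in> map_prod f f ` ?C" unfolding rel step.IH .
    show ?case
      by (rule Uniq_D[OF inj[OF fu S[OF step.hyps(2)]]]) (use 1 2 uv f(3) g(3) in auto)
  qed (rule root)
  then show "f = g" using f(1) g(1) C(2) by (intro PiE_ext[of f ?V _ g]) auto
qed

text \<open>Every such representative is a relabelling of t, and by rigidity distinct relabellings
  give distinct trees. So the abscissa-preserving bijections are counted, which permute freely at
  each abscissa.\<close>

lemma card_equiv_class_typed: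
  assumes t: "t \<in> injective_cayley_trees S" and ext: "\<tau> \<in> extensional {1..N}"
    and profile: "\<And>i. card {v \<in> vertices t. absc t v = i} = card {v \<in> {1..N}. \<tau> v = i}"
  shows "card {t'. (t, t') \<in> tree_equiv_rel S \<and> num_verts t' = N \<and> absc t' = \<tau>} =
    (\<Prod>i\<in>\<tau> ` {1..N}. fact (card {v \<in> {1..N}. \<tau> v = i}))"
proof -
  have "card (vertices t) = card {1..N}"
    by (rule card_eq_if_fibres_eq[OF _ _ profile]) (auto simp: vertices_def)
  then have N: "num_verts t = N" and V: "vertices t = {1..N}" by (auto simp: vertices_def)
  let ?V = "{1..N}"
  let ?F = "{f \<in> ?V \<rightarrow>\<^sub>E ?V. bij_betw f ?V ?V \<and> (\<forall>v\<in>?V. \<tau> (f v) = absc t v)}"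
  have tt: "embedded_cayley_tree S t" using t by (simp add: injective_cayley_trees_def)
  have "{t'. (t, t') \<in> tree_equiv_rel S \<and> num_verts t' = N \<and> absc t' = \<tau>} = relabel \<tau> t ` ?F"
  proof (intro equalityI subsetI)
    fix t' assume "t' \<in> {t'. (t, t') \<in> tree_equiv_rel S \<and> num_verts t' = N \<and> absc t' = \<tau>}"
    then have t': "embedded_cayley_tree S t'" "tree_equiv t t'" "num_verts t' = N" "absc t' = \<tau>"
      by (auto simp: tree_equiv_rel_def injective_cayley_trees_def)
    have V': "vertices t' = ?V" using t'(3) by (simp add: vertices_def)
    obtain f where f: "bij_betw f ?V ?V" "root t' = f (root t)"
      "child_rel t' = map_prod f f ` child_rel t" "\<And>v. v \<in> ?V \<Longrightarrow> \<tau> (f v) = absc t v"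
      using tree_equivE[OF tt t'(1,2)] unfolding V V' t'(4) by blast
    have C: "root t \<in> ?V" "child_rel t \<subseteq> ?V \<times> ?V"
      using tt unfolding embedded_cayley_tree_def rooted_tree_def V by auto
    let ?f = "restrict f ?V"
    have "map_prod ?f ?f ` child_rel t = map_prod f f ` child_rel t"
      using C(2) by (intro image_cong) auto
    then have "t' = relabel \<tau> t ?f"
      using f C(1) t'(3,4) N by (intro embedded_tree.equality) (auto simp: relabel_def)
    moreover have "bij_betw ?f ?V ?V" using f(1) by (simp add: bij_betw_restrict_eq)
    then have "?f \<in> ?F" using f(4) by (auto simp: bij_betw_def)
    ultimately show "t' \<in> relabel \<tau> t ` ?F" by blast
  next
    fix t' assume "t' \<in> relabel \<tau> t ` ?F"
    then obtain f where f: "t' = relabel \<tau> t f" "bij_betw f ?V ?V" "\<And>v. v \<in> ?V \<Longrightarrow> \<tau> (f v) = absc t v" by auto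
    then show "t' \<in> {t'. (t, t') \<in> tree_equiv_rel S \<and> num_verts t' = N \<and> absc t' = \<tau>}"
      using relabel_tree[OF t, of \<tau> f] ext t N unfolding V
      by (auto simp: tree_equiv_rel_def relabel_def)
  qed
  moreover have "inj_on (relabel \<tau> t) ?F" using inj_on_relabel[OF t, of \<tau>] ext unfolding V by simp
  ultimately have "card {t'. (t, t') \<in> tree_equiv_rel S \<and> num_verts t' = N \<and> absc t' = \<tau>} = card ?F"
    by (simp add: card_image)
  also have "?F = {f \<in> ?V \<rightarrow>\<^sub>E ?V. inj_on f ?V \<and> (\<forall>v\<in>?V. \<tau> (f v) = absc t v)}"
  proof -
    have "bij_betw f ?V ?V \<longleftrightarrow> inj_on f ?V" if "f \<in> ?V \<rightarrow>\<^sub>E ?V" for f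
      using that endo_inj_surj[of ?V f] by (auto simp: bij_betw_def)
    then show ?thesis by blast
  qed
  also have "card \<dots> = (\<Prod>i\<in>\<tau> ` ?V. fact (card {v \<in> ?V. \<tau> v = i}))"
  proof (rule card_type_preserving_injections)
    show "absc t ` ?V \<subseteq> \<tau> ` ?V"
    proof
      fix i assume "i \<in> absc t ` ?V"
      then have "card {v \<in> vertices t. absc t v = i} > 0" unfolding V by (subst card_gt_0_iff) auto
      then have "card {v \<in> ?V. \<tau> v = i} > 0" unfolding profile .
      then obtain v where "v \<in> ?V" "\<tau> v = i" by (subst (asm) card_gt_0_iff) auto
      then show "i \<in> \<tau> ` ?V" by blast
    qed
  qed (use profile V in auto)
  finally show ?thesis .
qed

section \<open>Counting\<close>

lemma finite_slot_placements:
  assumes "finite V" "finite E"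
  shows "finite (slot_placements V \<tau> E own tgt)"
  by (rule finite_subset[OF _ finite_PiE[of E "\<lambda>_. V"]]) (use assms in \<open>auto simp: slot_placements_def\<close>)

text \<open>Number the elements of a disjoint union of blocks of sizes \<open>k i\<close> and let
  \<open>\<tau>\<close> return the block index.\<close>

lemma exists_typing:
  fixes k :: "int \<Rightarrow> nat"
  assumes "finite I"
  obtains \<tau> where "\<tau> \<in> extensional {1..\<Sum>i\<in>I. k i}" "\<tau> ` {1..\<Sum>i\<in>I. k i} \<subseteq> I"
    "\<And>i. i \<in> I \<Longrightarrow> card {v \<in> {1..\<Sum>i\<in>I. k i}. \<tau> v = i} = k i"
proof -
  define N where "N = (\<Sum>i\<in>I. k i)"
  let ?D = "SIGMA i:I. {..<k i}"
  have "card {1..N} = card ?D" using assms by (simp add: card_SigmaI N_def)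
  then obtain h where h: "bij_betw h {1..N} ?D"
    using assms by (metis finite_same_card_bij finite_atLeastAtMost finite_SigmaI finite_lessThan)
  have inj: "inj_on h {1..N}" and img: "h ` {1..N} = ?D" using h by (auto simp: bij_betw_def)
  define \<tau> where "\<tau> = restrict (fst \<circ> h) {1..N}"
  have "card {v \<in> {1..N}. \<tau> v = i} = k i" if i: "i \<in> I" for i
  proof -
    have "h ` {v \<in> {1..N}. \<tau> v = i} = {x \<in> h ` {1..N}. fst x = i}" by (auto simp: \<tau>_def)
    also have "\<dots> = {i} \<times> {..<k i}" unfolding img using i by auto
    finally have "card (h ` {v \<in> {1..N}. \<tau> v = i}) = k i" by simp
    moreover have "inj_on h {v \<in> {1..N}. \<tau> v = i}" by (rule inj_on_subset[OF inj]) auto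
    ultimately show ?thesis by (simp add: card_image)
  qed
  moreover have "\<tau> ` {1..N} = fst ` h ` {1..N}" by (auto simp: \<tau>_def image_image)
  then have "\<tau> ` {1..N} \<subseteq> I" unfolding img by auto
  moreover have "\<tau> \<in> extensional {1..N}" by (simp add: \<tau>_def)
  ultimately show thesis using that unfolding N_def by blast
qed

section \<open>Counting the sets of occupied slots\<close>

lemma slot_choice_nonzero:
  assumes A: "A \<in> slot_choices S n V \<tau>" and V: "finite V" and us: "(u, s) \<in> A"
  shows "s \<in> S" "n (\<tau> u + s) s \<noteq> 0"
proof -
  show s: "s \<in> S" using A us by (auto simp: slot_choices_def)
  have "finite {w. (w, s) \<in> A \<and> \<tau> w = \<tau> u + s - s}"
    by (rule finite_subset[OF _ V]) (use A in \<open>auto simp: slot_choices_def\<close>)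
  then have "card {w. (w, s) \<in> A \<and> \<tau> w = \<tau> u + s - s} \<noteq> 0" using us by auto
  moreover have "card {w. (w, s) \<in> A \<and> \<tau> w = \<tau> u + s - s} = n (\<tau> u + s) s"
    using A s unfolding slot_choices_def by blast
  ultimately show "n (\<tau> u + s) s \<noteq> 0" by simp
qed

lemma finite_slot_choice:
  assumes A: "A \<in> slot_choices S n V \<tau>" and V: "finite V" and K: "finite {(i, s). s \<in> S \<and> n i s \<noteq> 0}"
  shows "finite A"
proof (rule finite_subset)
  show "A \<subseteq> V \<times> snd ` {(i, s). s \<in> S \<and> n i s \<noteq> 0}"
  proof clarify
    fix u s assume us: "(u, s) \<in> A"
    have "(\<tau> u + s, s) \<in> {(i, s). s \<in> S \<and> n i s \<noteq> 0}" using slot_choice_nonzero[OF A V us] by simp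
    moreover have "u \<in> V" using A us by (auto simp: slot_choices_def)
    ultimately show "u \<in> V \<and> s \<in> snd ` {(i, s). s \<in> S \<and> n i s \<noteq> 0}" 
      by (intro conjI image_eqI[of s snd "(\<tau> u + s, s)"]) auto
  qed
qed (use V K in auto)

text \<open>The conditions on a choice bind each pair (i, s) separately: the owners concerned form
  an arbitrary subset of size \<open>n i s\<close> of the vertices at i - s. Pairs with
  \<open>n i s = 0\<close> allow only the empty set, which leaves a finite index set.\<close>

lemma card_slot_choices:
  fixes V :: "'v set"
  assumes V: "finite V" and K: "finite {(i, s). s \<in> S \<and> n i s \<noteq> 0}"
  shows "finite (slot_choices S n V \<tau>)"
    and "card (slot_choices S n V \<tau>) =
      (\<Prod>(i, s)\<in>{(i, s). s \<in> S \<and> n i s \<noteq> 0}. card {v \<in> V. \<tau> v = i - s} choose n i s)"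
proof -
  let ?K = "{(i, s). s \<in> S \<and> n i s \<noteq> 0}"
  let ?P = "PiE ?K (\<lambda>(i, s). {B. B \<subseteq> {v \<in> V. \<tau> v = i - s} \<and> card B = n i s})"
  define h where "h A = restrict (\<lambda>(i, s). {u. (u, s) \<in> A \<and> \<tau> u = i - s}) ?K" for A :: "('v \<times> int) set"
  define g where "g F = {(u, s). (\<tau> u + s, s) \<in> ?K \<and> u \<in> F (\<tau> u + s, s)}"
    for F :: "int \<times> int \<Rightarrow> 'v set"
  \<comment> \<open>Outside \<open>?K\<close> the function F is \<open>undefined\<close>, so
    \<open>g\<close> must not consult it there; this is the reason for the case distinction.\<close>
  have fibre: "{u. (u, s) \<in> g F \<and> \<tau> u = i - s} = (if n i s = 0 then {} else F (i, s))"
    if F: "F \<in> ?P" and s: "s \<in> S" for F i s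
  proof (cases "n i s = 0")
    case True
    then have "n (\<tau> u + s) s = 0" if "\<tau> u = i - s" for u using that by simp
    with True show ?thesis by (auto simp: g_def)
  next
    case False
    then have "(i, s) \<in> ?K" using s by simp
    then have "F (i, s) \<subseteq> {v \<in> V. \<tau> v = i - s}" using PiE_mem[OF F, of "(i, s)"] by simp
    then show ?thesis using False s by (auto simp: g_def)
  qed
  have bij: "bij_betw h (slot_choices S n V \<tau>) ?P"
  proof (rule bij_betw_byWitness[where f' = g])
    show "\<forall>A\<in>slot_choices S n V \<tau>. g (h A) = A"
    proof
      fix A assume A: "A \<in> slot_choices S n V \<tau>"
      show "g (h A) = A" by (auto simp: g_def h_def dest: slot_choice_nonzero[OF A V])
    qed
    show "\<forall>F\<in>?P. h (g F) = F"
    proof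
      fix F assume F: "F \<in> ?P"
      show "h (g F) = F"
      proof (rule extensionalityI)
        show "h (g F) \<in> extensional ?K" by (simp add: h_def)
        show "F \<in> extensional ?K" using F by (auto simp: PiE_def)
        show "h (g F) x = F x" if "x \<in> ?K" for x
          using that fibre[OF F, of "snd x" "fst x"] by (auto simp: h_def)
      qed
    qed
    show "h ` slot_choices S n V \<tau> \<subseteq> ?P"
      by (rule image_subsetI) (auto simp: h_def slot_choices_def)
    show "g ` ?P \<subseteq> slot_choices S n V \<tau>"
    proof (rule image_subsetI)
      fix F assume F: "F \<in> ?P"
      have "card {u. (u, s) \<in> g F \<and> \<tau> u = i - s} = n i s" if "s \<in> S" for i s
        using fibre[OF F that, of i] PiE_mem[OF F, of "(i, s)"] that by auto
      moreover have "g F \<subseteq> V \<times> S"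
      proof clarify
        fix u s assume us: "(u, s) \<in> g F"
        then have k: "(\<tau> u + s, s) \<in> ?K" "u \<in> F (\<tau> u + s, s)" by (auto simp: g_def)
        with PiE_mem[OF F k(1)] show "u \<in> V \<and> s \<in> S" by auto
      qed
      ultimately show "g F \<in> slot_choices S n V \<tau>" by (simp add: slot_choices_def)
    qed
  qed
  have "finite ?P"
    using K V by (intro finite_PiE) auto
  then show "finite (slot_choices S n V \<tau>)" using bij_betw_finite[OF bij] by simp
  have "card (slot_choices S n V \<tau>) = card ?P" by (rule bij_betw_same_card[OF bij])
  also have "\<dots> = (\<Prod>(i, s)\<in>?K. card {B. B \<subseteq> {v \<in> V. \<tau> v = i - s} \<and> card B = n i s})"
    using K by (simp add: card_PiE split_beta)
  also have "\<dots> = (\<Prod>(i, s)\<in>?K. card {v \<in> V. \<tau> v = i - s} choose n i s)"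
    using V by (simp add: n_subsets)
  finally show "card (slot_choices S n V \<tau>) = \<dots>" .
qed

text \<open>Double counting: every class with the given out-types meets the labelled trees in the
  same number of elements. As that number is positive and classes are disjoint, the traces are
  distinct subsets of a finite set, which also gives finiteness.\<close>

lemma card_typed_trees_eq:
  assumes ext: "\<tau> \<in> extensional {1..N}"
    and profile: "\<And>i. card {v \<in> {1..N}. \<tau> v = i} = vertical_profile S n i"
    and fin: "\<And>i. finite {s \<in> S. n i s \<noteq> 0}"
    and L: "finite (typed_trees S n N \<tau>)"
  shows "finite (ary_trees_of_out_types S n)"
    and "card (typed_trees S n N \<tau>) =
      card (ary_trees_of_out_types S n) * (\<Prod>i\<in>\<tau> ` {1..N}. fact (vertical_profile S n i))"
proof -
  let ?L = "typed_trees S n N \<tau>" and ?Q = "ary_trees_of_out_types S n" and ?E = "tree_equiv_rel S"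
  let ?c = "\<Prod>i\<in>\<tau> ` {1..N}. fact (vertical_profile S n i) :: nat"
  note equiv = equiv_tree_equiv_rel[of S]
  have Q: "?Q \<subseteq> injective_cayley_trees S // ?E"
    by (auto simp: ary_trees_of_out_types_def ary_trees_def)
  have fibre: "card (T \<inter> ?L) = ?c" if T: "T \<in> ?Q" for T
  proof -
    from T Q obtain t where t: "t \<in> injective_cayley_trees S" "T = ?E `` {t}"
      by (blast elim: quotientE)
    have out: "\<And>t' i s. t' \<in> T \<Longrightarrow> s \<in> S \<Longrightarrow> card (out_type_vertices t' i s) = n i s"
      using T by (simp add: ary_trees_of_out_types_def)
    have "t \<in> T" unfolding t(2) by (rule equiv_class_self[OF equiv t(1)])
    then have "card {v \<in> vertices t. absc t v = i} = vertical_profile S n i" for i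
      using t(1) out fin by (intro card_abscissa_eq_vertical_profile) (auto simp: injective_cayley_trees_def)
    then have "card {t'. (t, t') \<in> ?E \<and> num_verts t' = N \<and> absc t' = \<tau>} = ?c"
      using card_equiv_class_typed[OF t(1) ext] profile by simp
    moreover have "T \<inter> ?L = {t'. (t, t') \<in> ?E \<and> num_verts t' = N \<and> absc t' = \<tau>}"
      using out unfolding t(2) by (auto simp: typed_trees_def tree_equiv_rel_def)
    ultimately show ?thesis by simp
  qed
  have c: "?c > 0" by (simp add: prod_pos)
  have disj: "T \<inter> T' = {}" if "T \<in> ?Q" "T' \<in> ?Q" "T \<noteq> T'" for T T'
    using quotient_disj[OF equiv, of T T'] that Q by blast
  have "inj_on (\<lambda>T. T \<inter> ?L) ?Q"
  proof (rule inj_onI)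
    fix T T' assume T: "T \<in> ?Q" "T' \<in> ?Q" "T \<inter> ?L = T' \<inter> ?L"
    have "T \<inter> ?L \<noteq> {}" using fibre[OF T(1)] c by force
    with T disj show "T = T'" by blast
  qed
  moreover have "finite ((\<lambda>T. T \<inter> ?L) ` ?Q)" by (rule finite_subset[of _ "Pow ?L"]) (use L in auto)
  ultimately show finQ: "finite ?Q" by (simp add: finite_image_iff)
  have "?L = (\<Union>T\<in>?Q. T \<inter> ?L)"
  proof (intro equalityI subsetI)
    fix t assume t: "t \<in> ?L"
    then have t': "t \<in> injective_cayley_trees S" by (simp add: typed_trees_def)
    have "?E `` {t} \<in> ?Q"
      unfolding ary_trees_of_out_types_def ary_trees_def
    proof (intro CollectI conjI quotientI[OF t'] ballI allI)
      fix t'' i s assume "t'' \<in> ?E `` {t}" "s \<in> S"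
      then show "card (out_type_vertices t'' i s) = n i s"
        using t tree_equiv_card_out_type_vertices[of S t t'' i s]
        by (auto simp: typed_trees_def tree_equiv_rel_def injective_cayley_trees_def)
    qed
    moreover have "t \<in> ?E `` {t}" by (rule equiv_class_self[OF equiv t'])
    ultimately show "t \<in> (\<Union>T\<in>?Q. T \<inter> ?L)" using t by blast
  qed auto
  then have "card ?L = card (\<Union>T\<in>?Q. T \<inter> ?L)" by simp
  also have "\<dots> = (\<Sum>T\<in>?Q. card (T \<inter> ?L))"
    by (rule card_UN_disjoint) (use finQ L disj in auto)
  also have "\<dots> = card ?Q * ?c" using fibre by simp
  finally show "card ?L = card ?Q * ?c" .
qed

text \<open>An infinite support would make \<open>sum'\<close> default to 0; \<open>fin\<close>
  ensures that the profile consists of genuine sums. Finiteness is part of the conclusion because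
  \<open>card\<close> is 0 on infinite sets.\<close>

theorem theorem2p4:
  fixes S :: "int set" and n :: "int \<Rightarrow> int \<Rightarrow> nat" and l r :: int
  assumes max_S: "1 \<in> S" "\<And>s. s \<in> S \<Longrightarrow> s \<le> 1"
    and fin: "\<And>i. finite {s \<in> S. n i s \<noteq> 0}"
    and min_S_or: "(-1 \<in> S \<and> (\<forall>s \<in> S. -1 \<le> s)) \<or> (\<forall>i < 0. \<forall>s \<in> S. n i s = 0)"
    and l_smallest: "vertical_profile S n l > 0"
      "\<And>i. vertical_profile S n i > 0 \<Longrightarrow> l \<le> i"
    and r_largest: "vertical_profile S n r > 0"
      "\<And>i. vertical_profile S n i > 0 \<Longrightarrow> i \<le> r"
    and pos: "\<And>i. l \<le> i \<Longrightarrow> i \<le> r \<Longrightarrow> vertical_profile S n i > 0"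
  shows "finite (ary_trees_of_out_types S n) \<and>
      real (card (ary_trees_of_out_types S n)) =
      real ((\<Prod>i = l..-1. n i (-1)) * (\<Prod>i = 1..r. n i 1)) /
      real (\<Prod>i = l..r. vertical_profile S n i) *
      real (prod' (\<lambda>(i, s). vertical_profile S n (i - s) choose n i s) (UNIV \<times> S))"
proof -
  define p where "p = vertical_profile S n"
  have p0: "p 0 > 0" by (simp add: p_def vertical_profile_def)
  then have lr: "l \<le> 0" "0 \<le> r" using l_smallest(2) r_largest(2) unfolding p_def by blast+
  have p_out: "p i = 0" if "i \<notin> {l..r}" for i
    using that l_smallest(2)[of i] r_largest(2)[of i] unfolding p_def by fastforce
  have p_pos: "p i > 0" if "i \<in> {l..r}" for i using that pos by (simp add: p_def)
  define N where "N = (\<Sum>i=l..r. p i)"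
  obtain \<tau> where \<tau>: "\<tau> \<in> extensional {1..N}" "\<tau> ` {1..N} \<subseteq> {l..r}"
    "\<And>i. i \<in> {l..r} \<Longrightarrow> card {v \<in> {1..N}. \<tau> v = i} = p i"
    using exists_typing[of "{l..r}" p] unfolding N_def by auto
  let ?V = "{1..N}"
  have profile: "card {v \<in> ?V. \<tau> v = i} = p i" for i
  proof (cases "i \<in> {l..r}")
    case False
    then have "{v \<in> ?V. \<tau> v = i} = {}" using \<tau>(2) by blast
    then show ?thesis using p_out[OF False] by (simp only: card.empty)
  qed (rule \<tau>(3))
  have img: "\<tau> ` ?V = {l..r}"
  proof (intro equalityI \<tau>(2) subsetI)
    fix i assume "i \<in> {l..r}"
    then have "card {v \<in> ?V. \<tau> v = i} > 0" using profile p_pos by simp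
    then obtain v where "v \<in> ?V" "\<tau> v = i" by (subst (asm) card_gt_0_iff) auto
    then show "i \<in> \<tau> ` ?V" by blast
  qed
  let ?K = "{(i, s). s \<in> S \<and> n i s \<noteq> 0}"
  have K_range: "i \<in> {l..r}" if "s \<in> S" "n i s \<noteq> 0" for i s
  proof (rule ccontr)
    assume "i \<notin> {l..r}"
    then have "sum' (n i) S = 0" using p_out unfolding p_def vertical_profile_def by fastforce
    then have "(\<Sum>s | s \<in> S \<and> n i s \<noteq> 0. n i s) = 0" using fin[of i] by (simp add: sum.G_def)
    then show False using fin[of i] that by auto
  qed
  have finK: "finite ?K"
  proof (rule finite_subset)
    show "?K \<subseteq> (SIGMA i : {l..r}. {s \<in> S. n i s \<noteq> 0})" using K_range by auto
    show "finite (SIGMA i : {l..r}. {s \<in> S. n i s \<noteq> 0})" using fin by (intro finite_SigmaI) auto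
  qed
  \<comment> \<open>The value does not mention the set of occupied slots.\<close>
  define F where "F = (\<Prod>i=l..r. fact (p i - 1)) * ((\<Prod>i = l..-1. n i (-1)) * (\<Prod>i = 1..r. n i 1))"
  have placements: "card (slot_placements ?V \<tau> A fst (slot_target \<tau>)) = F"
    if A: "A \<in> slot_choices S n ?V \<tau>" for A
  proof -
    have AV: "A \<subseteq> ?V \<times> S" using A by (simp add: slot_choices_def)
    have cardA: "card {u. (u, s) \<in> A \<and> \<tau> u = i - s} = n i s" if "s \<in> S" for i s
      using A that by (simp add: slot_choices_def)
    have nz: "n (\<tau> u + s) s \<noteq> 0" if "(u, s) \<in> A" for u s
      using slot_choice_nonzero(2)[OF A _ that] by simp
    have finA: "finite A" using finite_slot_choice[OF A _ finK] by simp
    have "card (slot_placements ?V \<tau> A fst (slot_target \<tau>)) =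
      (\<Prod>i\<in>\<tau> ` ?V. fact (card {v \<in> ?V. \<tau> v = i} - 1)) *
      (\<Prod>i\<in>\<tau> ` ?V - {0}. card {e \<in> A. slot_target \<tau> e = i \<and> \<tau> (fst e) = toward_zero i})"
    proof (rule card_slot_placements)
      show "card {v \<in> ?V. \<tau> v = i} = card {e \<in> A. slot_target \<tau> e = i} + (if i = 0 then 1 else 0)" for i
        unfolding profile using card_slot_choice_target[OF A _ fin, of i]
        by (simp add: p_def vertical_profile_def)
      show "slot_target \<tau> e - 1 \<le> \<tau> (fst e)" if "e \<in> A" for e
        using that AV max_S(2) by (auto simp: slot_target_def)
      \<comment> \<open>An occupied slot has a nonzero count \<open>n i s\<close> at its target i.
        For i < 0 this rules out the second alternative of \<open>min_S_or\<close>, and the first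
        bounds s below by -1.\<close>
      show "\<tau> (fst e) \<le> slot_target \<tau> e + 1" if "e \<in> A" "slot_target \<tau> e < 0" for e
      proof -
        obtain u s where e: "e = (u, s)" by (cases e)
        have s: "s \<in> S" using that AV e by auto
        have "-1 \<le> s" using min_S_or nz[of u s] that s unfolding e by (auto simp: slot_target_def)
        then show ?thesis by (simp add: e slot_target_def)
      qed
      show "toward_zero (\<tau> v) \<in> \<tau> ` ?V" if "v \<in> ?V" "\<tau> v \<noteq> 0" for v
      proof -
        have "\<tau> v \<in> {l..r}" using that img by blast
        then show ?thesis unfolding img using that lr by (auto simp: toward_zero_def)
      qed
    qed (use finA AV in auto)
    also have "\<dots> = (\<Prod>i=l..r. fact (p i - 1)) *
      (\<Prod>i\<in>{l..r} - {0}. if 0 < i then n i 1 else n i (-1))"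
      unfolding img profile
    proof (intro arg_cong2[of _ _ _ _ "(*)"] refl prod.cong)
      fix i assume i: "i \<in> {l..r} - {0}"
      \<comment> \<open>The jump that leads to i from its neighbour nearer to 0.\<close>
      define s :: int where "s = (if 0 < i then 1 else -1)"
      have tz: "toward_zero i = i - s" by (simp add: toward_zero_def s_def)
      have s: "s \<in> S"
      proof (cases "0 < i")
        case False
        then have "i < 0" using i by auto
        \<comment> \<open>Otherwise all \<open>n i s\<close> with i < 0 vanish, although
          \<open>p i\<close> is positive and the root does not contribute to it.\<close>
        have "-1 \<in> S"
        proof (rule ccontr)
          assume "-1 \<notin> S"
          with min_S_or \<open>i < 0\<close> have "\<forall>s\<in>S. n i s = 0" by blast
          then have "{s \<in> S. n i s \<noteq> 0} = {}" by simp
          then have "p i = 0" using \<open>i < 0\<close> by (simp add: p_def vertical_profile_def sum.G_def)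
          with p_pos i show False by force
        qed
        with False show ?thesis by (simp add: s_def)
      qed (use max_S in \<open>simp add: s_def\<close>)
      have "{e \<in> A. slot_target \<tau> e = i \<and> \<tau> (fst e) = toward_zero i} =
          (\<lambda>u. (u, s)) ` {u. (u, s) \<in> A \<and> \<tau> u = i - s}"
        unfolding tz by (auto simp: slot_target_def)
      then have "card {e \<in> A. slot_target \<tau> e = i \<and> \<tau> (fst e) = toward_zero i} = n i s"
        using cardA[OF s, of i] by (simp add: card_image inj_on_def)
      then show "card {e \<in> A. slot_target \<tau> e = i \<and> \<tau> (fst e) = toward_zero i} =
          (if 0 < i then n i 1 else n i (-1))" by (simp add: s_def)
    qed
    also have "{l..r} - {0} = {l..-1} \<union> {1..r}" using lr by auto
    also have "(\<Prod>i\<in>{l..-1} \<union> {1..r}. if 0 < i then n i 1 else n i (-1)) =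
        (\<Prod>i = l..-1. n i (-1)) * (\<Prod>i = 1..r. n i 1)"
      by (subst prod.union_disjoint) (auto intro!: arg_cong2[of _ _ _ _ "(*)"] prod.cong)
    finally show ?thesis unfolding F_def .
  qed
  let ?M = "\<Prod>(i, s)\<in>?K. p (i - s) choose n i s"
  note choices = card_slot_choices[OF _ finK, of ?V \<tau>]
  have bij: "bij_betw (placement_tree N \<tau>)
     (SIGMA A : slot_choices S n ?V \<tau>. slot_placements ?V \<tau> A fst (slot_target \<tau>)) (typed_trees S n N \<tau>)"
    using bij_betw_placement_tree[OF \<tau>(1) _ fin] profile by (simp add: p_def)
  have fin_place: "finite (slot_placements ?V \<tau> A fst (slot_target \<tau>))"
    if "A \<in> slot_choices S n ?V \<tau>" for A
    using finite_slot_choice[OF that _ finK] by (intro finite_slot_placements) auto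
  have finL: "finite (typed_trees S n N \<tau>)"
    using bij_betw_finite[OF bij] choices(1) fin_place by (simp add: finite_SigmaI)
  note eq = card_typed_trees_eq[OF \<tau>(1) _ fin finL]
  have "card (typed_trees S n N \<tau>) = ?M * F"
    using bij_betw_same_card[OF bij] choices placements fin_place profile by (simp add: card_SigmaI)
  moreover have "card (typed_trees S n N \<tau>) = card (ary_trees_of_out_types S n) * (\<Prod>i=l..r. fact (p i))"
    using eq(2) profile img by (simp add: p_def)
  \<comment> \<open>Against the factorials in \<open>F\<close>, only one factor \<open>p i\<close>
    of each \<open>fact (p i)\<close> survives.\<close>
  moreover have "(\<Prod>i=l..r. fact (p i)) = (\<Prod>i=l..r. p i) * (\<Prod>i=l..r. fact (p i - 1) :: nat)"
    unfolding prod.distrib[symmetric]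
  proof (rule prod.cong[OF refl])
    fix i assume "i \<in> {l..r}"
    then show "fact (p i) = p i * (fact (p i - 1) :: nat)"
      using fact_reduce[of "p i", where 'a = nat] p_pos by simp
  qed
  ultimately have "(card (ary_trees_of_out_types S n) * (\<Prod>i=l..r. p i)) * (\<Prod>i=l..r. fact (p i - 1)) =
      (?M * ((\<Prod>i = l..-1. n i (-1)) * (\<Prod>i = 1..r. n i 1))) * (\<Prod>i=l..r. fact (p i - 1))"
    by (simp add: F_def mult_ac)
  moreover have "(\<Prod>i=l..r. fact (p i - 1) :: nat) \<noteq> 0" by simp
  ultimately have main: "card (ary_trees_of_out_types S n) * (\<Prod>i=l..r. p i) =
      ?M * ((\<Prod>i = l..-1. n i (-1)) * (\<Prod>i = 1..r. n i 1))"
    by (simp only: mult_cancel2 simp_thms)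
  \<comment> \<open>Pairs with \<open>n i s = 0\<close> contribute a binomial coefficient over 0,
    that is 1, so the infinite product is the finite one.\<close>
  have M: "prod' (\<lambda>(i, s). p (i - s) choose n i s) (UNIV \<times> S) = ?M"
  proof -
    have "prod' (\<lambda>(i, s). p (i - s) choose n i s) (UNIV \<times> S) = prod' (\<lambda>(i, s). p (i - s) choose n i s) ?K"
    proof (rule prod.mono_neutral_right')
      show "\<forall>x\<in>UNIV \<times> S - ?K. (case x of (i, s) \<Rightarrow> p (i - s) choose n i s) = 1"
      proof
        fix x assume "x \<in> UNIV \<times> S - ?K"
        then obtain i s where "x = (i, s)" "n i s = 0" by auto
        then show "(case x of (i, s) \<Rightarrow> p (i - s) choose n i s) = 1" by simp
      qed
    qed auto
    then show ?thesis using finK by simp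
  qed
  have eq_frac: "x = b / c * m" if "c \<noteq> 0" "x * c = m * b" for x b c m :: real
    using that by (simp add: field_simps)
  have "(\<Prod>i=l..r. p i) > 0" using p_pos by (rule prod_pos)
  then have "real (\<Prod>i=l..r. p i) \<noteq> 0" by simp
  moreover have "real (card (ary_trees_of_out_types S n)) * real (\<Prod>i=l..r. p i) =
      real ?M * real ((\<Prod>i = l..-1. n i (-1)) * (\<Prod>i = 1..r. n i 1))"
    unfolding of_nat_mult[symmetric] main ..
  ultimately have "real (card (ary_trees_of_out_types S n)) =
      real ((\<Prod>i = l..-1. n i (-1)) * (\<Prod>i = 1..r. n i 1)) / real (\<Prod>i=l..r. p i) * real ?M"
    by (rule eq_frac)
  moreover have "finite (ary_trees_of_out_types S n)" using eq(1) profile by (simp add: p_def)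
  ultimately show ?thesis unfolding M[unfolded p_def] p_def by blast
qed

end
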